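(* Let $A,B,F\colon\mathsf{Set}\to\mathsf{Set}$ be functors with $A$ and $B$ $\omega$-continuous. Evaluation at $\omega$ gives a one-to-one correspondence between natural transformations $\alpha\colon F\bar A\Rightarrow\bar B$ (between functors $\mathrm{Ord}^{op}\to\mathsf{Set}$) and causal operations $\alpha_\omega\colon FA_\omega\to B_\omega$. Moreover, for any natural transformations $\alpha\colon F\bar A\Rightarrow\bar B$, $\beta\colon G\bar A\Rightarrow\bar B$ (with $G\colon\mathsf{Set}\to\mathsf{Set}$) and $\kappa\colon F\Rightarrow G$, we have $\beta\circ\kappa\bar A=\alpha$ if and only if $\beta_\omega\circ\kappa_{A_\omega}=\alpha_\omega$. Consequently the category $\mathrm{Causal}(A,B)$ is isomorphic to the category $\mathcal{K}(\bar A,\bar B)$.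
   Context: Final sequence of an endofunctor $A$ on $\mathsf{Set}$: $A_0=1$, $A_{i+1}=AA_i$, $A_j=\lim_{i<j}A_i$ at limit $j$, connecting maps $A_{j,i}\colon A_j\to A_i$ with $A_{i,i}=\mathrm{id}$, $A_{j+1,i+1}=AA_{j,i}$; viewed as $\bar A\colon\mathrm{Ord}^{op}\to\mathsf{Set}$. $A$ is $\omega$-continuous if it preserves limits of $\omega^{op}$-chains. A map $\alpha\colon FA_\omega\to B_\omega$ is a causal operation (from $A$ to $B$) if for every set $X$, all $f,g\colon X\to A_\omega$ and every $i<\omega$, $A_{\omega,i}\circ f=A_{\omega,i}\circ g$ implies $B_{\omega,i}\circ\alpha\circ Ff=B_{\omega,i}\circ\alpha\circ Fg$. $\mathrm{Causal}(A,B)$: objects $(F,\alpha)$ with $\alpha\colon FA_\omega\to B_\omega$ causal; morphisms $(F,\alpha)\to(G,\beta)$ are natural $\kappa\colon F\Rightarrow G$ with $\beta\circ\kappa_{A_\omega}=\alpha$. $\mathcal{K}(\bar A,\bar B)$: objects $(F,\alpha)$ with $F\colon\mathsf{Set}\to\mathsf{Set}$ and $\alpha\colon F\bar A\Rightarrow\bar B$ natural; morphisms $(F,\alpha)\to(G,\beta)$ are natural $\kappa\colon F\Rightarrow G$ with $\beta\circ\kappa\bar A=\alpha$. *)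

theory Defs
  imports "HOL-Library.FuncSet"
begin

section \<open>Universes of sets\<close>

text \<open>
  The ambient universe of sets is a type whose elements are sets, related to HOL sets by
  \<open>elts\<close>, and which satisfies the axioms of second-order ZF. (Choice is inherited
  from HOL.) The existence of such a type is not provable in HOL, so the axioms enter
  through a type class.
\<close>

class zf_universe =
  fixes elts :: "'a \<Rightarrow> 'a set"
  assumes elts_ext: "elts x = elts y \<Longrightarrow> x = y"
    and elts_separation: "Y \<subseteq> elts x \<Longrightarrow> \<exists>y. elts y = Y"
    and elts_Union: "\<exists>u. elts u = (\<Union>y \<in> elts x. elts y)"
    and elts_Pow: "\<exists>p. elts p = {y. elts y \<subseteq> elts x}"
    and elts_replacement: "\<exists>z. elts z = f ` elts x"
    and elts_infinity: "\<exists>z. elts z = range (g :: nat \<Rightarrow> 'a)"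
    and elts_foundation: "wf {(x, y). x \<in> elts y}"

text \<open>\<open>set_of X\<close> is only meaningful for \<open>X\<close> of the form \<open>elts x\<close>.\<close>

definition set_of :: "'v set \<Rightarrow> 'v::zf_universe"
  where "set_of X = (THE x. elts x = X)"


subsection \<open>Von Neumann ordinals\<close>

definition transitive :: "'v::zf_universe \<Rightarrow> bool"
  where "transitive x \<longleftrightarrow> (\<forall>y \<in> elts x. elts y \<subseteq> elts x)"

definition ordinal :: "'v::zf_universe \<Rightarrow> bool"
  where "ordinal x \<longleftrightarrow> transitive x \<and> (\<forall>y \<in> elts x. transitive y)"

definition ozero :: "'v::zf_universe"
  where "ozero = set_of {}"

definition osucc :: "'v \<Rightarrow> 'v::zf_universe"
  where "osucc x = set_of (insert x (elts x))"

definition omega :: "'v::zf_universe"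
  where "omega = set_of (range (\<lambda>n. (osucc ^^ n) ozero))"

definition limit_ordinal :: "'v::zf_universe \<Rightarrow> bool"
  where "limit_ordinal j \<longleftrightarrow>
    ordinal j \<and> j \<noteq> ozero \<and> (\<forall>i. ordinal i \<longrightarrow> j \<noteq> osucc i)"


section \<open>Categories\<close>

record ('o, 'm) category =
  Obj :: "'o set"
  Hom :: "'o \<Rightarrow> 'o \<Rightarrow> 'm set"
  Id :: "'o \<Rightarrow> 'm"
  Comp :: "'o \<Rightarrow> 'o \<Rightarrow> 'o \<Rightarrow> 'm \<Rightarrow> 'm \<Rightarrow> 'm"

text \<open>
  Hom-sets need not be disjoint, so composition (and the arrow part of a functor) takes
  the objects involved as arguments: \<open>Comp C x y z g f\<close> is the composite of
  \<open>f : x \<rightarrow> y\<close> and \<open>g : y \<rightarrow> z\<close>.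
\<close>

definition is_category :: "('o, 'm) category \<Rightarrow> bool"
  where "is_category C \<longleftrightarrow>
    (\<forall>x \<in> Obj C. Id C x \<in> Hom C x x) \<and>
    (\<forall>x \<in> Obj C. \<forall>y \<in> Obj C. \<forall>z \<in> Obj C. \<forall>f \<in> Hom C x y. \<forall>g \<in> Hom C y z.
      Comp C x y z g f \<in> Hom C x z) \<and>
    (\<forall>x \<in> Obj C. \<forall>y \<in> Obj C. \<forall>f \<in> Hom C x y.
      Comp C x x y f (Id C x) = f \<and> Comp C x y y (Id C y) f = f) \<and>
    (\<forall>w \<in> Obj C. \<forall>x \<in> Obj C. \<forall>y \<in> Obj C. \<forall>z \<in> Obj C.
      \<forall>f \<in> Hom C w x. \<forall>g \<in> Hom C x y. \<forall>h \<in> Hom C y z.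
        Comp C w x z (Comp C x y z h g) f = Comp C w y z h (Comp C w x y g f))"

record ('o, 'm, 'p, 'n) funct =
  FObj :: "'o \<Rightarrow> 'p"
  FArr :: "'o \<Rightarrow> 'o \<Rightarrow> 'm \<Rightarrow> 'n"

text \<open>
  Functors and natural transformations are required to be \<open>undefined\<close> outside their
  domain, so that HOL equality is equality of functors and natural transformations.
\<close>

definition is_functor ::
    "('o, 'm) category \<Rightarrow> ('p, 'n) category \<Rightarrow> ('o, 'm, 'p, 'n) funct \<Rightarrow> bool"
  where "is_functor C D F \<longleftrightarrow>
    (\<forall>x \<in> Obj C. FObj F x \<in> Obj D) \<and>
    (\<forall>x \<in> Obj C. \<forall>y \<in> Obj C. \<forall>f \<in> Hom C x y.
      FArr F x y f \<in> Hom D (FObj F x) (FObj F y)) \<and>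
    (\<forall>x \<in> Obj C. FArr F x x (Id C x) = Id D (FObj F x)) \<and>
    (\<forall>x \<in> Obj C. \<forall>y \<in> Obj C. \<forall>z \<in> Obj C. \<forall>f \<in> Hom C x y. \<forall>g \<in> Hom C y z.
      FArr F x z (Comp C x y z g f) =
        Comp D (FObj F x) (FObj F y) (FObj F z) (FArr F y z g) (FArr F x y f)) \<and>
    (\<forall>x. x \<notin> Obj C \<longrightarrow> FObj F x = undefined) \<and>
    (\<forall>x y f. \<not> (x \<in> Obj C \<and> y \<in> Obj C \<and> f \<in> Hom C x y) \<longrightarrow> FArr F x y f = undefined)"

definition functor_id :: "('o, 'm) category \<Rightarrow> ('o, 'm, 'o, 'm) funct"
  where "functor_id C =
    \<lparr>FObj = (\<lambda>x. if x \<in> Obj C then x else undefined),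
     FArr = (\<lambda>x y f. if x \<in> Obj C \<and> y \<in> Obj C \<and> f \<in> Hom C x y then f else undefined)\<rparr>"

definition functor_comp ::
    "('o, 'm) category \<Rightarrow> ('p, 'n, 'q, 'k) funct \<Rightarrow> ('o, 'm, 'p, 'n) funct \<Rightarrow> ('o, 'm, 'q, 'k) funct"
  where "functor_comp C G F =
    \<lparr>FObj = (\<lambda>x. if x \<in> Obj C then FObj G (FObj F x) else undefined),
     FArr = (\<lambda>x y f. if x \<in> Obj C \<and> y \<in> Obj C \<and> f \<in> Hom C x y
                      then FArr G (FObj F x) (FObj F y) (FArr F x y f) else undefined)\<rparr>"

definition isomorphic_categories :: "('o, 'm) category \<Rightarrow> ('p, 'n) category \<Rightarrow> bool"
  where "isomorphic_categories C D \<longleftrightarrow>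
    is_category C \<and> is_category D \<and>
    (\<exists>F G. is_functor C D F \<and> is_functor D C G \<and>
      functor_comp C G F = functor_id C \<and> functor_comp D F G = functor_id D)"

definition nat_trans ::
    "('o, 'm) category \<Rightarrow> ('p, 'n) category \<Rightarrow>
     ('o, 'm, 'p, 'n) funct \<Rightarrow> ('o, 'm, 'p, 'n) funct \<Rightarrow> ('o \<Rightarrow> 'n) \<Rightarrow> bool"
  where "nat_trans C D F G \<tau> \<longleftrightarrow>
    is_functor C D F \<and> is_functor C D G \<and>
    (\<forall>x \<in> Obj C. \<tau> x \<in> Hom D (FObj F x) (FObj G x)) \<and>
    (\<forall>x \<in> Obj C. \<forall>y \<in> Obj C. \<forall>f \<in> Hom C x y.
      Comp D (FObj F x) (FObj F y) (FObj G y) (\<tau> y) (FArr F x y f) =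
      Comp D (FObj F x) (FObj G x) (FObj G y) (FArr G x y f) (\<tau> x)) \<and>
    \<tau> \<in> extensional (Obj C)"

definition nat_id ::
    "('o, 'm) category \<Rightarrow> ('p, 'n) category \<Rightarrow> ('o, 'm, 'p, 'n) funct \<Rightarrow> 'o \<Rightarrow> 'n"
  where "nat_id C D F = (\<lambda>x \<in> Obj C. Id D (FObj F x))"

text \<open>Vertical composite of \<open>\<sigma> : F \<Rightarrow> G\<close> and \<open>\<tau> : G \<Rightarrow> H\<close>.\<close>

definition nat_comp ::
    "('o, 'm) category \<Rightarrow> ('p, 'n) category \<Rightarrow>
     ('o, 'm, 'p, 'n) funct \<Rightarrow> ('o, 'm, 'p, 'n) funct \<Rightarrow> ('o, 'm, 'p, 'n) funct \<Rightarrow>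
     ('o \<Rightarrow> 'n) \<Rightarrow> ('o \<Rightarrow> 'n) \<Rightarrow> 'o \<Rightarrow> 'n"
  where "nat_comp C D F G H \<tau> \<sigma> =
    (\<lambda>x \<in> Obj C. Comp D (FObj F x) (FObj G x) (FObj H x) (\<tau> x) (\<sigma> x))"

text \<open>The whiskering \<open>\<kappa>S : FS \<Rightarrow> GS\<close> of \<open>\<kappa> : F \<Rightarrow> G\<close> with a functor \<open>S\<close> on \<open>C\<close>.\<close>

definition whisker ::
    "('o, 'm) category \<Rightarrow> ('p \<Rightarrow> 'n) \<Rightarrow> ('o, 'm, 'p, 'k) funct \<Rightarrow> 'o \<Rightarrow> 'n"
  where "whisker C \<kappa> S = (\<lambda>x \<in> Obj C. \<kappa> (FObj S x))"

definition is_cone ::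
    "('o, 'm) category \<Rightarrow> ('p, 'n) category \<Rightarrow> ('o, 'm, 'p, 'n) funct \<Rightarrow> 'p \<Rightarrow> ('o \<Rightarrow> 'n) \<Rightarrow> bool"
  where "is_cone J C D X \<xi> \<longleftrightarrow>
    X \<in> Obj C \<and> (\<forall>i \<in> Obj J. \<xi> i \<in> Hom C X (FObj D i)) \<and>
    (\<forall>i \<in> Obj J. \<forall>j \<in> Obj J. \<forall>u \<in> Hom J i j.
      Comp C X (FObj D i) (FObj D j) (FArr D i j u) (\<xi> i) = \<xi> j)"

definition is_limit ::
    "('o, 'm) category \<Rightarrow> ('p, 'n) category \<Rightarrow> ('o, 'm, 'p, 'n) funct \<Rightarrow> 'p \<Rightarrow> ('o \<Rightarrow> 'n) \<Rightarrow> bool"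
  where "is_limit J C D L \<pi> \<longleftrightarrow>
    is_cone J C D L \<pi> \<and>
    (\<forall>X \<xi>. is_cone J C D X \<xi> \<longrightarrow>
      (\<exists>!h. h \<in> Hom C X L \<and> (\<forall>i \<in> Obj J. Comp C X L (FObj D i) (\<pi> i) h = \<xi> i)))"


section \<open>Endofunctors of Set and their final sequences\<close>

definition Sets :: "('v::zf_universe, 'v \<Rightarrow> 'v) category"
  where "Sets =
    \<lparr>Obj = UNIV,
     Hom = (\<lambda>X Y. elts X \<rightarrow>\<^sub>E elts Y),
     Id = (\<lambda>X. \<lambda>x \<in> elts X. x),
     Comp = (\<lambda>X Y Z g f. compose (elts X) g f)\<rparr>"

type_synonym 'v endofunctor = "('v, 'v \<Rightarrow> 'v, 'v, 'v \<Rightarrow> 'v) funct"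

type_synonym 'v ord_diagram = "('v, unit, 'v, 'v \<Rightarrow> 'v) funct"

definition ord_op_on :: "'v set \<Rightarrow> ('v::zf_universe, unit) category"
  where "ord_op_on U =
    \<lparr>Obj = U,
     Hom = (\<lambda>j i. if elts i \<subseteq> elts j then {()} else {}),
     Id = (\<lambda>i. ()),
     Comp = (\<lambda>k j i g f. ())\<rparr>"

definition Ord_op :: "('v::zf_universe, unit) category"
  where "Ord_op = ord_op_on {i. ordinal i}"

text \<open>The opposite of the poset of ordinals below \<open>j\<close>.\<close>

definition below_op :: "'v \<Rightarrow> ('v::zf_universe, unit) category"
  where "below_op j = ord_op_on (elts j)"

definition omega_continuous :: "'v::zf_universe endofunctor \<Rightarrow> bool"
  where "omega_continuous A \<longleftrightarrow>
    (\<forall>(D :: 'v ord_diagram) L \<pi>.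
      is_functor (below_op omega) Sets D \<and> is_limit (below_op omega) Sets D L \<pi> \<longrightarrow>
      is_limit (below_op omega) Sets (functor_comp (below_op omega) A D)
        (FObj A L) (\<lambda>i. FArr A L (FObj D i) (\<pi> i)))"

text \<open>
  The clauses determine the sequence up to the choice of limits. In particular the maps
  into \<open>S\<^sub>0\<close> and into \<open>S\<^sub>i\<close> for limit \<open>i\<close> are forced by functoriality and the
  universal properties.
\<close>

definition final_sequence :: "'v::zf_universe endofunctor \<Rightarrow> 'v ord_diagram \<Rightarrow> bool"
  where "final_sequence A S \<longleftrightarrow>
    is_functor Ord_op Sets S \<and>
    FObj S ozero = osucc ozero \<and>
    (\<forall>i. ordinal i \<longrightarrow> FObj S (osucc i) = FObj A (FObj S i)) \<and>
    (\<forall>i j. ordinal i \<and> ordinal j \<and> elts i \<subseteq> elts j \<longrightarrow>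
      FArr S (osucc j) (osucc i) () = FArr A (FObj S j) (FObj S i) (FArr S j i ())) \<and>
    (\<forall>j. limit_ordinal j \<longrightarrow> is_limit (below_op j) Sets S (FObj S j) (\<lambda>i. FArr S j i ()))"


section \<open>Causal operations\<close>

text \<open>Here \<open>S\<close> and \<open>T\<close> are the final sequences of the functors \<open>A\<close> and \<open>B\<close>.\<close>

definition causal_operation ::
    "'v::zf_universe endofunctor \<Rightarrow> 'v ord_diagram \<Rightarrow> 'v ord_diagram \<Rightarrow> ('v \<Rightarrow> 'v) \<Rightarrow> bool"
  where "causal_operation F S T \<alpha> \<longleftrightarrow>
    \<alpha> \<in> Hom Sets (FObj F (FObj S omega)) (FObj T omega) \<and>
    (\<forall>X. \<forall>f \<in> Hom Sets X (FObj S omega). \<forall>g \<in> Hom Sets X (FObj S omega). \<forall>i \<in> elts omega.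
      Comp Sets X (FObj S omega) (FObj S i) (FArr S omega i ()) f =
      Comp Sets X (FObj S omega) (FObj S i) (FArr S omega i ()) g \<longrightarrow>
      Comp Sets (FObj F X) (FObj T omega) (FObj T i) (FArr T omega i ())
        (Comp Sets (FObj F X) (FObj F (FObj S omega)) (FObj T omega) \<alpha>
          (FArr F X (FObj S omega) f)) =
      Comp Sets (FObj F X) (FObj T omega) (FObj T i) (FArr T omega i ())
        (Comp Sets (FObj F X) (FObj F (FObj S omega)) (FObj T omega) \<alpha>
          (FArr F X (FObj S omega) g)))"

definition Causal_cat ::
    "'v::zf_universe ord_diagram \<Rightarrow> 'v ord_diagram \<Rightarrow>
     ('v endofunctor \<times> ('v \<Rightarrow> 'v), 'v \<Rightarrow> 'v \<Rightarrow> 'v) category"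
  where "Causal_cat S T =
    \<lparr>Obj = {(F, \<alpha>). is_functor Sets Sets F \<and> causal_operation F S T \<alpha>},
     Hom = (\<lambda>(F, \<alpha>) (G, \<beta>). {\<kappa>. nat_trans Sets Sets F G \<kappa> \<and>
       Comp Sets (FObj F (FObj S omega)) (FObj G (FObj S omega)) (FObj T omega)
         \<beta> (\<kappa> (FObj S omega)) = \<alpha>}),
     Id = (\<lambda>(F, \<alpha>). nat_id Sets Sets F),
     Comp = (\<lambda>(F, \<alpha>) (G, \<beta>) (H, \<gamma>) \<mu> \<kappa>. nat_comp Sets Sets F G H \<mu> \<kappa>)\<rparr>"

definition K_cat ::
    "'v::zf_universe ord_diagram \<Rightarrow> 'v ord_diagram \<Rightarrow>
     ('v endofunctor \<times> ('v \<Rightarrow> 'v \<Rightarrow> 'v), 'v \<Rightarrow> 'v \<Rightarrow> 'v) category"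
  where "K_cat S T =
    \<lparr>Obj = {(F, \<alpha>). is_functor Sets Sets F \<and>
       nat_trans Ord_op Sets (functor_comp Ord_op F S) T \<alpha>},
     Hom = (\<lambda>(F, \<alpha>) (G, \<beta>). {\<kappa>. nat_trans Sets Sets F G \<kappa> \<and>
       nat_comp Ord_op Sets (functor_comp Ord_op F S) (functor_comp Ord_op G S) T
         \<beta> (whisker Ord_op \<kappa> S) = \<alpha>}),
     Id = (\<lambda>(F, \<alpha>). nat_id Sets Sets F),
     Comp = (\<lambda>(F, \<alpha>) (G, \<beta>) (H, \<gamma>) \<mu> \<kappa>. nat_comp Sets Sets F G H \<mu> \<kappa>)\<rparr>"


section \<open>Existence of final sequences\<close>

text \<open>
  Every endofunctor of \<open>Sets\<close> has a final sequence, so \<open>final_sequence\<close> is satisfiable.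
\<close>

definition small :: "'v::zf_universe set \<Rightarrow> bool"
  where "small X \<longleftrightarrow> (\<exists>x. elts x = X)"

lemma elts_set_of: "small X \<Longrightarrow> elts (set_of X) = X"
  unfolding small_def set_of_def by (metis (mono_tags, lifting) elts_ext theI')

lemma small_elts [simp]: "small (elts x)"
  by (auto simp: small_def)

lemma small_subset: "small X \<Longrightarrow> Y \<subseteq> X \<Longrightarrow> small Y"
  unfolding small_def using elts_separation by blast

lemma small_empty [simp]: "small {}"
  using small_subset small_elts by blast

lemma small_image: "small X \<Longrightarrow> small (f ` X)" for f :: "'v::zf_universe \<Rightarrow> 'v"
  unfolding small_def using elts_replacement[of f] by auto

lemma small_UN:
  fixes I :: "'v::zf_universe set" and f :: "'v \<Rightarrow> 'v set"
  assumes "small I" "\<And>i. i \<in> I \<Longrightarrow> small (f i)"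
  shows "small (\<Union>i \<in> I. f i)"
proof -
  have *: "elts (set_of ((\<lambda>i. set_of (f i)) ` I)) = (\<lambda>i. set_of (f i)) ` I"
    by (rule elts_set_of[OF small_image[OF assms(1)]])
  obtain u where "elts u = (\<Union>y \<in> (\<lambda>i. set_of (f i)) ` I. elts y)"
    using elts_Union[of "set_of ((\<lambda>i. set_of (f i)) ` I)"] unfolding * by blast
  then have "elts u = (\<Union>i \<in> I. f i)"
    using elts_set_of[OF assms(2)] by simp
  then show ?thesis unfolding small_def by blast
qed

lemma small_pair [simp]: "small {a, b}"
proof -
  have "range (\<lambda>n::nat. if n = 0 then a else b) = {a, b}" by auto
  then show ?thesis using elts_infinity unfolding small_def by metis
qed

lemma small_insert: "small X \<Longrightarrow> small (insert a X)"
proof -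
  assume "small X"
  then obtain x where x: "elts x = X" by (auto simp: small_def)
  have a: "elts (set_of {a}) = {a}" using elts_set_of small_pair[of a a] by force
  have "small (\<Union>y \<in> {x, set_of {a}}. elts y)" by (rule small_UN) auto
  then show ?thesis by (simp add: x a)
qed

lemma elts_ozero [simp]: "elts ozero = {}"
  by (simp add: ozero_def elts_set_of)

lemma elts_osucc [simp]: "elts (osucc x) = insert x (elts x)"
  by (simp add: osucc_def elts_set_of small_insert)

lemma mem_induct [case_names mem]:
  fixes P :: "'v::zf_universe \<Rightarrow> bool"
  assumes "\<And>x. (\<And>y. y \<in> elts x \<Longrightarrow> P y) \<Longrightarrow> P x"
  shows "P x"
  using wf_induct_rule[OF elts_foundation, of P x] assms by blast

lemma mem_irrefl [simp]: "x \<notin> elts x"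
  using wf_not_refl[OF elts_foundation, of x] by simp

lemma mem_asym: "x \<in> elts y \<Longrightarrow> y \<notin> elts x"
  using wf_not_sym[OF elts_foundation, of x y] by simp

lemma ordinal_mem: "ordinal j \<Longrightarrow> i \<in> elts j \<Longrightarrow> ordinal i"
  unfolding ordinal_def transitive_def by blast

lemma ordinal_subset: "ordinal j \<Longrightarrow> i \<in> elts j \<Longrightarrow> elts i \<subseteq> elts j"
  unfolding ordinal_def transitive_def by blast

lemma ordinal_osucc: "ordinal i \<Longrightarrow> ordinal (osucc i)"
  unfolding ordinal_def transitive_def by auto

lemma ordinal_ozero [simp]: "ordinal ozero"
  unfolding ordinal_def transitive_def by simp

lemma ordinal_linear: "ordinal i \<Longrightarrow> ordinal j \<Longrightarrow> i \<in> elts j \<or> i = j \<or> j \<in> elts i"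
proof (induction i arbitrary: j rule: mem_induct)
  case (mem i)
  note i = mem.IH mem.prems(1)
  from \<open>ordinal j\<close> show ?case
  proof (induction j rule: mem_induct)
    case (mem j)
    show ?case
    proof (rule ccontr)
      assume c: "\<not> ?case"
      have "elts i \<subseteq> elts j"
        using c i mem.prems ordinal_mem ordinal_subset by blast
      moreover have "elts j \<subseteq> elts i"
        using c i mem ordinal_mem ordinal_subset by blast
      ultimately show False using c elts_ext by blast
    qed
  qed
qed

lemma ordinal_le_iff: "ordinal i \<Longrightarrow> ordinal j \<Longrightarrow> elts i \<subseteq> elts j \<longleftrightarrow> i \<in> elts j \<or> i = j"
  using ordinal_linear[of i j] ordinal_subset[of j i] mem_irrefl[of j] by blast

lemma osucc_inject [simp]: "osucc i = osucc j \<longleftrightarrow> i = j"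
proof
  assume "osucc i = osucc j"
  then have e: "insert i (elts i) = insert j (elts j)" using elts_osucc by metis
  show "i = j"
  proof (rule ccontr)
    assume "i \<noteq> j"
    then have "i \<in> elts j" "j \<in> elts i" using e by auto
    then show False using mem_asym[of i j] by simp
  qed
qed simp

lemma osucc_neq_ozero [simp]: "osucc i \<noteq> ozero" "ozero \<noteq> osucc i"
  using elts_ozero elts_osucc by (metis insert_not_empty)+

lemma ordinal_cases [consumes 1, case_names zero succ limit]:
  assumes "ordinal j"
  obtains "j = ozero" | k where "ordinal k" "j = osucc k" | "limit_ordinal j"
  using assms unfolding limit_ordinal_def by blast

lemma limit_osucc: "limit_ordinal j \<Longrightarrow> i \<in> elts j \<Longrightarrow> osucc i \<in> elts j"
proof -
  assume j: "limit_ordinal j" and i: "i \<in> elts j"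
  then have o: "ordinal j" "ordinal i" using ordinal_mem[of j i] by (simp_all add: limit_ordinal_def)
  have "osucc i = j \<or> osucc i \<in> elts j"
    using ordinal_linear[OF ordinal_osucc[OF o(2)] o(1)] i mem_asym[OF i] by auto
  then show ?thesis using j o(2) by (auto simp: limit_ordinal_def)
qed

lemma elts_omega: "elts omega = range (\<lambda>n. (osucc ^^ n) ozero)"
  unfolding omega_def by (rule elts_set_of) (use elts_infinity in \<open>auto simp: small_def\<close>)

lemma limit_ordinal_omega: "limit_ordinal (omega :: 'v::zf_universe)"
proof -
  have sub: "elts ((osucc ^^ n) ozero) \<subseteq> elts (omega :: 'v)" for n
    by (induction n) (auto simp: elts_omega)
  have o: "ordinal ((osucc ^^ n) (ozero :: 'v))" for n
    by (induction n) (auto intro: ordinal_osucc)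
  have "ordinal (omega :: 'v)"
    unfolding ordinal_def
  proof
    show "transitive (omega :: 'v)"
      unfolding transitive_def using sub by (auto simp: elts_omega)
    show "\<forall>y \<in> elts (omega :: 'v). transitive y"
      using o by (auto simp: elts_omega ordinal_def)
  qed
  moreover have "ozero \<in> elts (omega :: 'v)"
    unfolding elts_omega by (rule range_eqI[of _ _ 0]) simp
  then have "(omega :: 'v) \<noteq> ozero" by auto
  moreover have "omega \<noteq> osucc i" for i :: 'v
  proof
    assume eq: "omega = osucc i"
    have "i \<in> elts omega" unfolding eq by simp
    then obtain n where "i = (osucc ^^ n) ozero" by (auto simp: elts_omega)
    then have "osucc i \<in> elts omega"
      unfolding elts_omega by (intro range_eqI[of _ _ "Suc n"]) simp
    then show False unfolding eq by (simp del: elts_osucc)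
  qed
  ultimately show ?thesis unfolding limit_ordinal_def by blast
qed

definition kpair :: "'v \<Rightarrow> 'v \<Rightarrow> 'v::zf_universe"
  where "kpair a b = set_of {set_of {a, a}, set_of {a, b}}"

lemma kpair_inject [simp]: "kpair a b = kpair c d \<longleftrightarrow> a = c \<and> b = d"
proof
  have e: "elts (set_of {u, w}) = {u, w}" for u w :: 'a
    by (rule elts_set_of[OF small_pair])
  assume "kpair a b = kpair c d"
  then have "elts ` elts (kpair a b) = elts ` elts (kpair c d)"
    by (rule arg_cong)
  then have "{{a, a}, {a, b}} = {{c, c}, {c, d}}"
    unfolding kpair_def e image_insert image_empty .
  then show "a = c \<and> b = d"
    by (metis doubleton_eq_iff)
qed simp

definition tuple :: "'v \<Rightarrow> ('v \<Rightarrow> 'v) \<Rightarrow> 'v::zf_universe"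
  where "tuple j t = set_of ((\<lambda>i. kpair i (t i)) ` elts j)"

definition proj :: "'v \<Rightarrow> 'v \<Rightarrow> 'v::zf_universe"
  where "proj c i = (THE x. kpair i x \<in> elts c)"

lemma proj_tuple [simp]: "i \<in> elts j \<Longrightarrow> proj (tuple j t) i = t i"
  unfolding proj_def tuple_def by (auto simp: elts_set_of small_image)

lemma tuple_cong: "(\<And>i. i \<in> elts j \<Longrightarrow> t i = s i) \<Longrightarrow> tuple j t = tuple j s"
  unfolding tuple_def by (metis (mono_tags, lifting) image_cong)

lemma small_tuples: "small {tuple j t | t. \<forall>i \<in> elts j. t i \<in> elts (X i)}"
proof -
  let ?P = "\<Union>i \<in> elts j. \<Union>x \<in> elts (X i). {kpair i x}"
  have "small {a}" for a :: 'a using small_pair[of a a] by simp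
  then have "small ?P" by (intro small_UN) auto
  then obtain p where p: "elts p = ?P" unfolding small_def by blast
  have "small {y. elts y \<subseteq> elts p}" unfolding small_def by (rule elts_Pow)
  moreover have "{tuple j t | t. \<forall>i \<in> elts j. t i \<in> elts (X i)} \<subseteq> {y. elts y \<subseteq> elts p}"
    unfolding p tuple_def by (auto simp: elts_set_of small_image)
  ultimately show ?thesis using small_subset by blast
qed

text \<open>
  The sequence and its connecting maps are defined together by recursion: stage \<open>j\<close>
  consists of the set \<open>A\<^sub>j\<close> and the maps \<open>A\<^sub>j \<rightarrow> A\<^sub>i\<close> for \<open>i \<le> j\<close>.
  The components of a map into the limit \<open>A\<^sub>i\<close> out of a successor stage factor through
  \<open>A\<^sub>m\<^sub>+\<^sub>1 \<rightarrow> A\<^sub>m\<close>.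
\<close>

type_synonym 'v stage = "'v \<times> ('v \<Rightarrow> 'v \<Rightarrow> 'v)"

definition limit_stage :: "('v \<Rightarrow> 'v stage) \<Rightarrow> 'v \<Rightarrow> 'v::zf_universe"
  where "limit_stage R j = set_of {tuple j t | t. (\<forall>i \<in> elts j. t i \<in> elts (fst (R i))) \<and>
    (\<forall>i \<in> elts j. \<forall>m \<in> elts i. snd (R i) m (t i) = t m)}"

definition succ_map :: "'v::zf_universe endofunctor \<Rightarrow> ('v \<Rightarrow> 'v stage) \<Rightarrow> 'v \<Rightarrow> 'v \<Rightarrow> 'v \<Rightarrow> 'v"
  where "succ_map A R k i = (\<lambda>x \<in> elts (FObj A (fst (R k))).
     if i = osucc k then x
     else if i = ozero then ozero
     else if limit_ordinal i then
       tuple i (\<lambda>m. snd (R (osucc m)) m (FArr A (fst (R k)) (fst (R m)) (snd (R k) m) x))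
     else let m = (THE m. i = osucc m) in FArr A (fst (R k)) (fst (R m)) (snd (R k) m) x)"

definition next_stage :: "'v::zf_universe endofunctor \<Rightarrow> ('v \<Rightarrow> 'v stage) \<Rightarrow> 'v \<Rightarrow> 'v stage"
  where "next_stage A R j =
    (if j = ozero then (osucc ozero, \<lambda>i. \<lambda>x \<in> elts (osucc ozero). x)
     else if limit_ordinal j then
       (limit_stage R j,
        \<lambda>i. \<lambda>x \<in> elts (limit_stage R j). if i = j then x else proj x i)
     else let k = (THE k. j = osucc k) in
       (FObj A (fst (R k)),
        \<lambda>i. if ordinal i \<and> elts i \<subseteq> elts j then succ_map A R k i else undefined))"

definition stage :: "'v::zf_universe endofunctor \<Rightarrow> 'v \<Rightarrow> 'v stage"
  where "stage A = wfrec {(x, y). x \<in> elts y} (next_stage A)"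

lemma limit_stage_cong:
  assumes j: "ordinal j" and eq: "\<And>i. i \<in> elts j \<Longrightarrow> R i = R' i"
  shows "limit_stage R j = limit_stage R' j"
  unfolding limit_stage_def using eq by (intro arg_cong[where f = set_of]) force

lemma succ_map_cong:
  assumes k: "ordinal k" and i: "ordinal i" "elts i \<subseteq> elts (osucc k)"
    and eq: "\<And>m. m \<in> elts (osucc k) \<Longrightarrow> R m = R' m"
  shows "succ_map A R k i = succ_map A R' k i"
proof (cases "i = osucc k")
  case True
  then show ?thesis using eq unfolding succ_map_def by (auto intro!: restrict_ext)
next
  case False
  have le: "i \<in> elts (osucc k)"
    using ordinal_le_iff[OF i(1) ordinal_osucc[OF k]] i(2) False by blast
  have "R m = R' m" "R (osucc m) = R' (osucc m)" if "limit_ordinal i" "m \<in> elts i" for m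
    using that eq limit_osucc i by blast+
  moreover have "R (THE m. i = osucc m) = R' (THE m. i = osucc m)" if "\<exists>m. i = osucc m"
    using that eq i(2) by auto
  moreover have "R k = R' k" using eq by simp
  ultimately have eqs: "\<And>m. limit_ordinal i \<Longrightarrow> m \<in> elts i \<Longrightarrow> R m = R' m"
    "\<And>m. limit_ordinal i \<Longrightarrow> m \<in> elts i \<Longrightarrow> R (osucc m) = R' (osucc m)"
    "\<exists>m. i = osucc m \<Longrightarrow> R (THE m. i = osucc m) = R' (THE m. i = osucc m)"
    "R k = R' k" by blast+
  from i(1) show ?thesis
  proof (cases i rule: ordinal_cases)
    case zero
    then show ?thesis by (simp add: succ_map_def eqs(4))
  next
    case (succ m)
    then have "\<not> limit_ordinal i" by (auto simp: limit_ordinal_def)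
    then show ?thesis using eqs(3) succ by (simp add: succ_map_def eqs(4) restrict_def fun_eq_iff)
  next
    case limit
    have "tuple i (\<lambda>m. snd (R (osucc m)) m (FArr A (fst (R k)) (fst (R m)) (snd (R k) m) x)) =
          tuple i (\<lambda>m. snd (R' (osucc m)) m (FArr A (fst (R' k)) (fst (R' m)) (snd (R' k) m) x))" for x
      by (rule tuple_cong) (simp add: eqs(1,2)[OF limit] eqs(4))
    then show ?thesis using limit by (simp add: succ_map_def eqs(4) restrict_def fun_eq_iff)
  qed
qed

lemma stage_unfold:
  assumes j: "ordinal j"
  shows "stage A j = next_stage A (stage A) j"
proof -
  let ?r = "{(x, y). x \<in> elts (y :: 'a)}"
  have c: "cut (stage A) ?r j i = stage A i" if "i \<in> elts j" for i
    using that by (simp add: cut_def)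
  have "stage A j = next_stage A (cut (stage A) ?r j) j"
    unfolding stage_def by (rule wfrec[OF elts_foundation])
  also have "\<dots> = next_stage A (stage A) j"
    using j
  proof (cases j rule: ordinal_cases)
    case zero
    then show ?thesis by (simp add: next_stage_def)
  next
    case (succ k)
    have "succ_map A (cut (stage A) ?r j) k i = succ_map A (stage A) k i"
      if "ordinal i" "elts i \<subseteq> elts j" for i
      using that c succ by (intro succ_map_cong) auto
    moreover have "\<not> limit_ordinal j" "j \<noteq> ozero" using succ by (auto simp: limit_ordinal_def)
    ultimately show ?thesis using c[of k] succ
      by (auto simp: next_stage_def Let_def fun_eq_iff)
  next
    case limit
    then have "j \<noteq> ozero" by (auto simp: limit_ordinal_def)
    then show ?thesis using limit limit_stage_cong[OF j, of "cut (stage A) ?r j" "stage A"] c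
      by (simp add: next_stage_def)
  qed
  finally show ?thesis .
qed


context
  fixes A :: "'v::zf_universe endofunctor"
  assumes A: "is_functor Sets Sets A"
begin

abbreviation (input) "ob j \<equiv> fst (stage A j)"
abbreviation (input) "mp j \<equiv> snd (stage A j)"

lemma A_hom: "f \<in> elts X \<rightarrow>\<^sub>E elts Y \<Longrightarrow> FArr A X Y f \<in> elts (FObj A X) \<rightarrow>\<^sub>E elts (FObj A Y)"
  using A unfolding is_functor_def Sets_def by simp

lemma A_id: "FArr A X X (\<lambda>x \<in> elts X. x) = (\<lambda>x \<in> elts (FObj A X). x)"
  using A unfolding is_functor_def Sets_def by simp

lemma A_comp:
  assumes "f \<in> elts X \<rightarrow>\<^sub>E elts Y" "g \<in> elts Y \<rightarrow>\<^sub>E elts Z" "x \<in> elts (FObj A X)"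
  shows "FArr A Y Z g (FArr A X Y f x) = FArr A X Z (compose (elts X) g f) x"
proof -
  have "FArr A X Z (compose (elts X) g f) =
      compose (elts (FObj A X)) (FArr A Y Z g) (FArr A X Y f)"
    using A assms(1,2) unfolding is_functor_def Sets_def by simp
  then show ?thesis using assms(3) by (simp add: compose_def)
qed

lemma stage_zero: "ob ozero = osucc ozero" "mp ozero i = (\<lambda>x \<in> elts (osucc ozero). x)"
  by (simp_all add: stage_unfold[of ozero] next_stage_def)

lemma ob_succ: "ordinal k \<Longrightarrow> ob (osucc k) = FObj A (ob k)"
  by (subst stage_unfold) (auto simp: ordinal_osucc next_stage_def limit_ordinal_def)

lemma mp_succ:
  assumes "ordinal k" "ordinal i" "elts i \<subseteq> elts (osucc k)"
  shows "mp (osucc k) i = succ_map A (stage A) k i"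
  using assms by (subst stage_unfold) (auto simp: ordinal_osucc next_stage_def limit_ordinal_def)

lemma mp_succ_self: "ordinal k \<Longrightarrow> mp (osucc k) (osucc k) = (\<lambda>x \<in> elts (ob (osucc k)). x)"
  by (simp add: mp_succ ordinal_osucc succ_map_def ob_succ)

lemma mp_succ_zero: "ordinal k \<Longrightarrow> mp (osucc k) ozero = (\<lambda>x \<in> elts (ob (osucc k)). ozero)"
  by (simp add: mp_succ ordinal_osucc succ_map_def ob_succ)

lemma mp_succ_succ:
  assumes "ordinal k" "m \<in> elts k" "x \<in> elts (ob (osucc k))"
  shows "mp (osucc k) (osucc m) x = FArr A (ob k) (ob m) (mp k m) x"
proof -
  have m: "ordinal m" using assms ordinal_mem by blast
  have "\<not> limit_ordinal (osucc m)" using m by (auto simp: limit_ordinal_def)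
  moreover have "m \<noteq> k" using assms by auto
  moreover have "elts (osucc m) \<subseteq> elts (osucc k)"
    using assms(2) ordinal_subset[OF assms(1,2)] by auto
  ultimately show ?thesis using assms m
    by (simp add: mp_succ ordinal_osucc succ_map_def ob_succ)
qed

lemma mp_succ_limit:
  assumes "ordinal k" "limit_ordinal i" "i \<in> elts (osucc k)" "x \<in> elts (ob (osucc k))"
  shows "mp (osucc k) i x =
    tuple i (\<lambda>m. mp (osucc m) m (FArr A (ob k) (ob m) (mp k m) x))"
proof -
  have "ordinal i" "i \<noteq> ozero" "i \<noteq> osucc k" using assms by (auto simp: limit_ordinal_def)
  moreover have "elts i \<subseteq> elts (osucc k)"
    using ordinal_subset[OF ordinal_osucc[OF assms(1)] assms(3)] .
  ultimately show ?thesis using assms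
    by (simp add: mp_succ succ_map_def ob_succ)
qed

lemma elts_ob_limit:
  assumes "limit_ordinal j"
  shows "elts (ob j) = {tuple j t | t. (\<forall>i \<in> elts j. t i \<in> elts (ob i)) \<and>
    (\<forall>i \<in> elts j. \<forall>m \<in> elts i. mp i m (t i) = t m)}" (is "_ = ?S")
proof -
  have "small ?S" by (rule small_subset[OF small_tuples[of j ob]]) blast
  moreover have "ob j = set_of ?S"
    using assms by (subst stage_unfold) (auto simp: next_stage_def limit_ordinal_def limit_stage_def)
  ultimately show ?thesis by (simp add: elts_set_of)
qed

lemma mp_limit:
  assumes "limit_ordinal j"
  shows "mp j i = (\<lambda>x \<in> elts (ob j). if i = j then x else proj x i)"
proof -
  have "j \<noteq> ozero" "ordinal j" using assms by (auto simp: limit_ordinal_def)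
  then show ?thesis using assms by (simp add: stage_unfold[of j] next_stage_def)
qed

definition "stage_ok j \<longleftrightarrow>
  (\<forall>i. ordinal i \<longrightarrow> elts i \<subseteq> elts j \<longrightarrow> mp j i \<in> elts (ob j) \<rightarrow>\<^sub>E elts (ob i)) \<and>
  mp j j = (\<lambda>x \<in> elts (ob j). x) \<and>
  (\<forall>i m x. ordinal i \<longrightarrow> ordinal m \<longrightarrow> elts i \<subseteq> elts j \<longrightarrow> elts m \<subseteq> elts i \<longrightarrow>
    x \<in> elts (ob j) \<longrightarrow> mp i m (mp j i x) = mp j m x)"

lemma stage_okD:
  assumes "stage_ok j"
  shows "\<And>i. ordinal i \<Longrightarrow> elts i \<subseteq> elts j \<Longrightarrow> mp j i \<in> elts (ob j) \<rightarrow>\<^sub>E elts (ob i)"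
    and "mp j j = (\<lambda>x \<in> elts (ob j). x)"
    and "\<And>i m x. ordinal i \<Longrightarrow> ordinal m \<Longrightarrow> elts i \<subseteq> elts j \<Longrightarrow> elts m \<subseteq> elts i \<Longrightarrow>
      x \<in> elts (ob j) \<Longrightarrow> mp i m (mp j i x) = mp j m x"
  using assms unfolding stage_ok_def by blast+

lemma stage_ok_compose:
  assumes "stage_ok j" "ordinal i" "ordinal m" "elts i \<subseteq> elts j" "elts m \<subseteq> elts i"
  shows "compose (elts (ob j)) (mp i m) (mp j i) = mp j m"
proof
  fix x
  have "mp j m \<in> elts (ob j) \<rightarrow>\<^sub>E elts (ob m)" using stage_okD(1) assms by blast
  then show "compose (elts (ob j)) (mp i m) (mp j i) x = mp j m x"
    using stage_okD(3)[OF assms] by (cases "x \<in> elts (ob j)") (auto simp: compose_def)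
qed

lemma stage_ok_limit:
  assumes j: "limit_ordinal j" and IH: "\<And>i. i \<in> elts j \<Longrightarrow> stage_ok i"
  shows "stage_ok j"
proof -
  have oj: "ordinal j" using j by (simp add: limit_ordinal_def)
  have hom: "mp j i \<in> elts (ob j) \<rightarrow>\<^sub>E elts (ob i)" if "ordinal i" "elts i \<subseteq> elts j" for i
  proof -
    have "i = j \<or> i \<in> elts j" using ordinal_le_iff[of i j] oj that by blast
    then show ?thesis by (auto simp: mp_limit[OF j] elts_ob_limit[OF j])
  qed
  have com: "mp i m (mp j i x) = mp j m x"
    if o: "ordinal i" "ordinal m" and le: "elts i \<subseteq> elts j" "elts m \<subseteq> elts i" and x: "x \<in> elts (ob j)"
    for i m x
  proof (cases "i = j")
    case True
    then show ?thesis using x by (simp add: mp_limit[OF j])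
  next
    case False
    then have i: "i \<in> elts j" using ordinal_le_iff[of i j] oj o le by blast
    obtain t where t: "x = tuple j t" "\<forall>i \<in> elts j. t i \<in> elts (ob i)"
        "\<forall>i \<in> elts j. \<forall>m \<in> elts i. mp i m (t i) = t m"
      using x elts_ob_limit[OF j] by blast
    have m: "m = i \<or> m \<in> elts i" using ordinal_le_iff[of m i] o le by blast
    have mj: "m \<in> elts j" "m \<noteq> j" using m i ordinal_subset[OF oj i] by auto
    have "mp j i x = t i" "mp j m x = t m"
      using x i mj False t(1) by (simp_all add: mp_limit[OF j])
    then show ?thesis using m t(2,3) i stage_okD(2)[OF IH[OF i]] by auto
  qed
  show ?thesis unfolding stage_ok_def using hom com by (auto simp: mp_limit[OF j])
qed

lemma mp_succ_succ_le:
  assumes "stage_ok k" "ordinal k" "ordinal m" "elts m \<subseteq> elts k" "x \<in> elts (ob (osucc k))"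
  shows "mp (osucc k) (osucc m) x = FArr A (ob k) (ob m) (mp k m) x"
proof (cases "m = k")
  case True
  then show ?thesis using assms A_id stage_okD(2)[OF assms(1)] by (simp add: mp_succ_self ob_succ)
next
  case False
  then show ?thesis using assms ordinal_le_iff[of m k] mp_succ_succ by blast
qed

lemma A_mp_comp:
  assumes "stage_ok j" "stage_ok i" "ordinal i" "ordinal m" "elts i \<subseteq> elts j" "elts m \<subseteq> elts i"
    "x \<in> elts (FObj A (ob j))"
  shows "FArr A (ob i) (ob m) (mp i m) (FArr A (ob j) (ob i) (mp j i) x) =
    FArr A (ob j) (ob m) (mp j m) x"
  using A_comp[of "mp j i" "ob j" "ob i" "mp i m" "ob m" x] stage_okD(1)
    stage_ok_compose[of j i m] assms by simp

lemma stage_ok_succ: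
  assumes k: "ordinal k" and IH: "\<And>i. i \<in> elts (osucc k) \<Longrightarrow> stage_ok i"
  shows "stage_ok (osucc k)"
proof -
  let ?j = "osucc k"
  have okk: "stage_ok k" using IH by simp
  have oi: "ordinal i" "elts i \<subseteq> elts k" if "i \<in> elts ?j" for i
    using that k ordinal_mem[OF k] ordinal_subset[OF k] by auto
  have Amp: "FArr A (ob k) (ob m) (mp k m) x \<in> elts (ob (osucc m))"
    if "x \<in> elts (ob ?j)" "m \<in> elts ?j" for m x
    using A_hom[OF stage_okD(1)[OF okk oi[OF that(2)]]] that(1) oi(1)[OF that(2)] k
    by (auto simp: ob_succ)
  have sub_succ: "elts m \<subseteq> elts (osucc m)" for m :: 'v by auto
  text \<open>Projecting the components of a map into a limit stage.\<close>
  have comp: "mp m n (mp (osucc m) m (FArr A (ob k) (ob m) (mp k m) x)) =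
      mp (osucc n) n (FArr A (ob k) (ob n) (mp k n) x)"
    if x: "x \<in> elts (ob ?j)" and m: "osucc m \<in> elts ?j" and n: "n \<in> elts m" for m n x
  proof -
    have om: "ordinal m" using oi[OF m] ordinal_mem by (metis elts_osucc insertI1)
    have on: "ordinal n" using om n ordinal_mem by blast
    have mk: "m \<in> elts k" using oi(2)[OF m] by auto
    have mj: "m \<in> elts ?j" and nj: "n \<in> elts ?j" using mk n oi(2)[of m] by auto
    have nm: "elts n \<subseteq> elts m" using ordinal_subset[OF om n] .
    let ?y = "FArr A (ob k) (ob m) (mp k m) x"
    have y: "?y \<in> elts (ob (osucc m))" using Amp[OF x mj] .
    have okm: "stage_ok m" "stage_ok (osucc m)" using IH m mj by blast+
    have sn: "elts (osucc n) \<subseteq> elts (osucc m)" using n nm by auto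
    have "mp m n (mp (osucc m) m ?y) = mp (osucc m) n ?y"
      using stage_okD(3)[OF okm(2) om on sub_succ nm y] .
    also have "\<dots> = mp (osucc n) n (mp (osucc m) (osucc n) ?y)"
      using stage_okD(3)[OF okm(2) ordinal_osucc[OF on] on sn sub_succ y] by simp
    also have "mp (osucc m) (osucc n) ?y = FArr A (ob m) (ob n) (mp m n) ?y"
      using mp_succ_succ[OF om n y] .
    also have "\<dots> = FArr A (ob k) (ob n) (mp k n) x"
      using A_mp_comp[OF okk okm(1) om on oi(2)[OF mj] nm] x k by (simp add: ob_succ)
    finally show ?thesis .
  qed
  have hom: "mp ?j i \<in> elts (ob ?j) \<rightarrow>\<^sub>E elts (ob i)" if o: "ordinal i" and le: "elts i \<subseteq> elts ?j" for i
  proof -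
    have ext: "mp ?j i \<in> extensional (elts (ob ?j))"
      using mp_succ[OF k o le] k by (simp add: succ_map_def ob_succ)
    have "mp ?j i x \<in> elts (ob i)" if x: "x \<in> elts (ob ?j)" for x
    proof (cases "i = ?j")
      case True
      then show ?thesis using x k by (simp add: mp_succ_self)
    next
      case False
      then have i: "i \<in> elts ?j" using ordinal_le_iff[OF o ordinal_osucc[OF k]] le by blast
      from o show ?thesis
      proof (cases i rule: ordinal_cases)
        case zero
        then show ?thesis using x k by (simp add: mp_succ_zero stage_zero)
      next
        case (succ m)
        then have m: "m \<in> elts k" using oi(2)[OF i] by auto
        then show ?thesis using mp_succ_succ[OF k m x] Amp[OF x, of m] succ by simp
      next
        case limit
        let ?t = "\<lambda>m. mp (osucc m) m (FArr A (ob k) (ob m) (mp k m) x)"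
        have s: "osucc m \<in> elts ?j" "m \<in> elts ?j" if "m \<in> elts i" for m
          using limit_osucc[OF limit that] le that by blast+
        have "?t m \<in> elts (ob m)" if m: "m \<in> elts i" for m
          using stage_okD(1)[OF IH[OF s(1)[OF m]] oi(1)[OF s(2)[OF m]] sub_succ] Amp[OF x s(2)[OF m]] by blast
        moreover have "mp m n (?t m) = ?t n" if "m \<in> elts i" "n \<in> elts m" for m n
          using comp[OF x s(1)[OF that(1)] that(2)] .
        ultimately show ?thesis
          unfolding mp_succ_limit[OF k limit i x] elts_ob_limit[OF limit] by blast
      qed
    qed
    then show ?thesis using ext by (auto simp: PiE_def)
  qed
  have com: "mp i m (mp ?j i x) = mp ?j m x"
    if o: "ordinal i" "ordinal m" and le: "elts i \<subseteq> elts ?j" "elts m \<subseteq> elts i" and x: "x \<in> elts (ob ?j)"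
    for i m x
  proof (cases "i = ?j")
    case True
    then show ?thesis using x k by (simp add: mp_succ_self)
  next
    case False
    then have i: "i \<in> elts ?j" using ordinal_le_iff[OF o(1) ordinal_osucc[OF k]] le by blast
    have y: "mp ?j i x \<in> elts (ob i)" using hom[OF o(1) le(1)] x by blast
    have oki: "stage_ok i" using IH[OF i] .
    show ?thesis
    proof (cases "m = i")
      case True
      then show ?thesis using stage_okD(2)[OF oki] y by simp
    next
      case False
      then have m: "m \<in> elts i" using ordinal_le_iff[OF o(2,1)] le by blast
      have mj: "m \<in> elts ?j" using m le by blast
      have i0: "i \<noteq> ozero" using m by auto
      from o(2) show ?thesis
      proof (cases m rule: ordinal_cases)
        case zero
        have "elts m \<subseteq> elts ?j" using le by blast
        then have "mp ?j m x \<in> elts (ob m)" using hom[OF o(2)] x by blast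
        moreover have "mp i m (mp ?j i x) \<in> elts (ob m)"
          using stage_okD(1)[OF oki o(2) le(2)] y by blast
        ultimately show ?thesis using zero by (simp add: stage_zero)
      next
        case (succ n)
        have nk: "n \<in> elts k" using oi(2)[OF mj] succ by auto
        have rhs: "mp ?j m x = FArr A (ob k) (ob n) (mp k n) x"
          using mp_succ_succ[OF k nk x] succ by simp
        from o(1) show ?thesis
        proof (cases i rule: ordinal_cases)
          case zero
          then show ?thesis using i0 by simp
        next
          case (succ p)
          have pk: "p \<in> elts k" using oi(2)[OF i] succ by auto
          have np: "elts n \<subseteq> elts p" "n \<in> elts p"
          proof -
            show "n \<in> elts p" using m \<open>m = osucc n\<close> succ ordinal_subset[of p m] by auto
            then show "elts n \<subseteq> elts p" using ordinal_subset succ by blast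
          qed
          have l: "mp ?j i x = FArr A (ob k) (ob p) (mp k p) x"
            using mp_succ_succ[OF k pk x] succ by simp
          have "mp i m (mp ?j i x) = FArr A (ob p) (ob n) (mp p n) (mp ?j i x)"
            using mp_succ_succ[of p n "mp ?j i x"] np y succ \<open>m = osucc n\<close> by simp
          also have "\<dots> = FArr A (ob k) (ob n) (mp k n) x"
            unfolding l using A_mp_comp[OF okk IH[of p] _ _ _ np(1)] x k pk succ(1) \<open>ordinal n\<close> oi(2)[of p]
            by (simp add: ob_succ)
          finally show ?thesis using rhs by simp
        next
          case limit
          have "i \<noteq> m" using False by simp
          have on: "ordinal n" by fact
          have "mp i m (mp ?j i x) = mp (osucc m) m (FArr A (ob k) (ob m) (mp k m) x)"
            using y m \<open>i \<noteq> m\<close> mp_succ_limit[OF k limit i x] by (simp add: mp_limit[OF limit])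
          also have "\<dots> = FArr A (ob m) (ob n) (mp m n) (FArr A (ob k) (ob m) (mp k m) x)"
            using mp_succ_succ[OF o(2) _ Amp[OF x mj], of n] succ by simp
          also have "\<dots> = FArr A (ob k) (ob n) (mp k n) x"
            using A_mp_comp[OF okk IH[OF mj] o(2) on oi(2)[OF mj]] x k succ by (auto simp: ob_succ)
          finally show ?thesis using rhs by simp
        qed
      next
        case limit
        note lm = limit
        have rhs: "mp ?j m x = tuple m (\<lambda>n. mp (osucc n) n (FArr A (ob k) (ob n) (mp k n) x))"
          using mp_succ_limit[OF k limit mj x] .
        have on: "ordinal n" "elts n \<subseteq> elts m" if "n \<in> elts m" for n
          using that o(2) ordinal_mem ordinal_subset by blast+
        from o(1) show ?thesis
        proof (cases i rule: ordinal_cases)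
          case zero
          then show ?thesis using i0 by simp
        next
          case (succ p)
          have pk: "p \<in> elts k" using oi(2)[OF i] succ by auto
          have l: "mp ?j i x = FArr A (ob k) (ob p) (mp k p) x"
            using mp_succ_succ[OF k pk x] succ by simp
          have mp': "elts m \<subseteq> elts p" using m succ ordinal_subset[of p m] by auto
          have e: "FArr A (ob p) (ob n) (mp p n) (FArr A (ob k) (ob p) (mp k p) x) =
              FArr A (ob k) (ob n) (mp k n) x" if "n \<in> elts m" for n
            using A_mp_comp[OF okk IH[of p] succ(1) on(1)[OF that] oi(2)[of p]] on(2)[OF that] mp' x k pk
            by (simp add: ob_succ)
          have "mp i m (mp ?j i x) =
              tuple m (\<lambda>n. mp (osucc n) n (FArr A (ob p) (ob n) (mp p n) (mp ?j i x)))"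
            using mp_succ_limit[OF succ(1) lm, of "mp ?j i x"] m y succ by simp
          also have "\<dots> = mp ?j m x"
            unfolding rhs by (rule tuple_cong) (simp add: l e)
          finally show ?thesis .
        next
          case limit
          have "i \<noteq> m" using False by simp
          have e: "FArr A (ob m) (ob n) (mp m n) (FArr A (ob k) (ob m) (mp k m) x) =
              FArr A (ob k) (ob n) (mp k n) x" if "n \<in> elts m" for n
            using A_mp_comp[OF okk IH[OF mj] o(2) on(1)[OF that] oi(2)[OF mj] on(2)[OF that]] x k
            by (simp add: ob_succ)
          have "mp i m (mp ?j i x) = mp (osucc m) m (FArr A (ob k) (ob m) (mp k m) x)"
            using y m \<open>i \<noteq> m\<close> mp_succ_limit[OF k limit i x] by (simp add: mp_limit[OF limit])
          also have "\<dots> = tuple m (\<lambda>n. mp (osucc n) n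
              (FArr A (ob m) (ob n) (mp m n) (FArr A (ob k) (ob m) (mp k m) x)))"
            using mp_succ_limit[OF o(2) lm _ Amp[OF x mj]] by simp
          also have "\<dots> = mp ?j m x"
            unfolding rhs by (rule tuple_cong) (simp add: e)
          finally show ?thesis .
        qed
      qed
    qed
  qed
  show ?thesis unfolding stage_ok_def using hom com mp_succ_self[OF k] by blast
qed

lemma stage_ok: "ordinal j \<Longrightarrow> stage_ok j"
proof (induction j rule: mem_induct)
  case (mem j)
  then have IH: "stage_ok i" if "i \<in> elts j" for i using that ordinal_mem by blast
  from mem.prems show ?case
  proof (cases j rule: ordinal_cases)
    case zero
    have "elts i = {} \<longleftrightarrow> i = ozero" for i :: 'v using elts_ext[of i ozero] by auto
    then show ?thesis using zero by (auto simp: stage_ok_def stage_zero)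
  next
    case (succ k)
    then show ?thesis using stage_ok_succ IH by blast
  next
    case limit
    then show ?thesis using stage_ok_limit IH by blast
  qed
qed

lemma final_sequence_exists: "\<exists>S. final_sequence A S"
proof -
  define S :: "'v ord_diagram" where "S =
    \<lparr>FObj = (\<lambda>j. if ordinal j then ob j else undefined),
     FArr = (\<lambda>j i u. if ordinal j \<and> ordinal i \<and> elts i \<subseteq> elts j then mp j i else undefined)\<rparr>"
  have So: "FObj S j = ob j" if "ordinal j" for j using that by (simp add: S_def)
  have Sa: "FArr S j i u = mp j i" if "ordinal j" "ordinal i" "elts i \<subseteq> elts j" for j i u
    using that by (simp add: S_def)
  have "is_functor Ord_op Sets S"
    unfolding is_functor_def Ord_op_def ord_op_on_def Sets_def
    using stage_okD(1,2)[OF stage_ok] stage_ok_compose[OF stage_ok]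
    by (auto simp: S_def)
  moreover have "FArr S (osucc j) (osucc i) () = FArr A (FObj S j) (FObj S i) (FArr S j i ())"
    if o: "ordinal i" "ordinal j" and le: "elts i \<subseteq> elts j" for i j
  proof -
    have le': "elts (osucc i) \<subseteq> elts (osucc j)" using le ordinal_le_iff[OF o] by auto
    have "mp (osucc j) (osucc i) = FArr A (ob j) (ob i) (mp j i)"
    proof
      fix x
      have e1: "mp (osucc j) (osucc i) \<in> extensional (elts (ob (osucc j)))"
        using stage_okD(1)[OF stage_ok[OF ordinal_osucc[OF o(2)]] ordinal_osucc[OF o(1)] le'] by (simp add: PiE_def)
      have e2: "FArr A (ob j) (ob i) (mp j i) \<in> extensional (elts (ob (osucc j)))"
        using A_hom[OF stage_okD(1)[OF stage_ok[OF o(2)] o(1) le]] ob_succ[OF o(2)] by (simp add: PiE_def)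
      show "mp (osucc j) (osucc i) x = FArr A (ob j) (ob i) (mp j i) x"
      proof (cases "x \<in> elts (ob (osucc j))")
        case True
        then show ?thesis by (rule mp_succ_succ_le[OF stage_ok[OF o(2)] o(2,1) le])
      next
        case False
        then show ?thesis using extensional_arb[OF e1] extensional_arb[OF e2] by metis
      qed
    qed
    then show ?thesis using o le le' by (simp add: So Sa ordinal_osucc)
  qed
  moreover have "is_limit (below_op j) Sets S (FObj S j) (\<lambda>i. FArr S j i ())" if j: "limit_ordinal j" for j
  proof -
    have oj: "ordinal j" using j by (simp add: limit_ordinal_def)
    have oi: "ordinal i" "elts i \<subseteq> elts j" "i \<noteq> j" if "i \<in> elts j" for i
      using that ordinal_mem[OF oj] ordinal_subset[OF oj] by auto
    note ok = stage_ok[OF oj]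
    have cone: "is_cone (below_op j) Sets S (FObj S j) (\<lambda>i. FArr S j i ())"
      unfolding is_cone_def below_op_def ord_op_on_def Sets_def
      using stage_okD(1)[OF ok] stage_ok_compose[OF ok] oi oj
      by (auto simp: So Sa)
    have pr: "FArr S j i () c = proj c i" if "i \<in> elts j" "c \<in> elts (ob j)" for i c
      using that oi[OF that(1)] oj by (simp add: Sa mp_limit[OF j])
    have "\<exists>!h. h \<in> Hom Sets X (FObj S j) \<and>
        (\<forall>i \<in> Obj (below_op j). Comp Sets X (FObj S j) (FObj S i) (FArr S j i ()) h = \<xi> i)"
      if c: "is_cone (below_op j) Sets S X \<xi>" for X \<xi>
    proof -
      have xi: "\<xi> i \<in> elts X \<rightarrow>\<^sub>E elts (ob i)" if "i \<in> elts j" for i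
      proof -
        have "\<xi> i \<in> elts X \<rightarrow>\<^sub>E elts (FObj S i)"
          using c that unfolding is_cone_def below_op_def ord_op_on_def Sets_def by simp
        then show ?thesis by (simp only: So[OF oi(1)[OF that]])
      qed
      have xc: "mp i m (\<xi> i x) = \<xi> m x" if "i \<in> elts j" "m \<in> elts i" "x \<in> elts X" for i m x
      proof -
        have m: "m \<in> elts j" "elts m \<subseteq> elts i"
          using that(1,2) oi ordinal_subset[of i m] by blast+
        then have "compose (elts X) (FArr S i m ()) (\<xi> i) = \<xi> m"
          using c that(1) unfolding is_cone_def below_op_def ord_op_on_def Sets_def by simp
        then have "compose (elts X) (mp i m) (\<xi> i) = \<xi> m"
          using Sa[OF oi(1)[OF that(1)] oi(1)[OF m(1)] m(2)] by simp
        then show ?thesis using that(3) by (metis compose_eq)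
      qed
      let ?h = "\<lambda>x \<in> elts X. tuple j (\<lambda>i. \<xi> i x)"
      have hh: "?h \<in> elts X \<rightarrow>\<^sub>E elts (ob j)"
      proof -
        have "tuple j (\<lambda>i. \<xi> i x) \<in> elts (ob j)" if "x \<in> elts X" for x
          unfolding elts_ob_limit[OF j] using xi xc that by blast
        then show ?thesis by auto
      qed
      show ?thesis
      proof (rule ex1I[of _ ?h])
        have "compose (elts X) (FArr S j i ()) ?h = \<xi> i" if i: "i \<in> elts j" for i
        proof
          fix x
          show "compose (elts X) (FArr S j i ()) ?h x = \<xi> i x"
          proof (cases "x \<in> elts X")
            case True
            then have "?h x \<in> elts (ob j)" using hh by blast
            then show ?thesis using pr[OF i] i True by (simp add: compose_def)
          next
            case False
            then show ?thesis using xi[OF i] by (auto simp: compose_def)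
          qed
        qed
        then show "?h \<in> Hom Sets X (FObj S j) \<and>
            (\<forall>i \<in> Obj (below_op j). Comp Sets X (FObj S j) (FObj S i) (FArr S j i ()) ?h = \<xi> i)"
          using hh oj by (simp add: Sets_def below_op_def ord_op_on_def So)
      next
        fix h
        assume "h \<in> Hom Sets X (FObj S j) \<and>
            (\<forall>i \<in> Obj (below_op j). Comp Sets X (FObj S j) (FObj S i) (FArr S j i ()) h = \<xi> i)"
        then have h: "h \<in> elts X \<rightarrow>\<^sub>E elts (ob j)"
          and hc: "\<And>i. i \<in> elts j \<Longrightarrow> compose (elts X) (FArr S j i ()) h = \<xi> i"
          using oj by (auto simp: Sets_def below_op_def ord_op_on_def So)
        show "h = ?h"
        proof
          fix x
          show "h x = ?h x"
          proof (cases "x \<in> elts X")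
            case True
            then have hx: "h x \<in> elts (ob j)" using h by blast
            then obtain t where t: "h x = tuple j t" using elts_ob_limit[OF j] by blast
            have "t i = \<xi> i x" if i: "i \<in> elts j" for i
              using pr[OF i hx] compose_eq[OF True, of "FArr S j i ()" h] hc[OF i] t i by simp
            then show ?thesis using t True tuple_cong[of j t "\<lambda>i. \<xi> i x"] by simp
          next
            case False
            then show ?thesis using h by (auto simp: PiE_def extensional_def)
          qed
        qed
      qed
    qed
    then show ?thesis using cone unfolding is_limit_def by blast
  qed
  ultimately have "final_sequence A S"
    unfolding final_sequence_def
    by (simp add: So stage_zero ob_succ ordinal_osucc)
  then show ?thesis by blast
qed

end

end

theory Submission
  imports Defs
begin

text \<open>
  Continuity of \<open>A\<close> makes \<open>A\<^sub>\<omega>\<^sub>+\<^sub>1 \<rightarrow> A\<^sub>\<omega>\<close> invertible, and by transfinite induction all maps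
  \<open>A\<^sub>j \<rightarrow> A\<^sub>\<omega>\<close> with \<open>j \<ge> \<omega>\<close>; the same holds for \<open>B\<close>. So a natural transformation is
  determined at stages \<open>j \<ge> \<omega>\<close> by its component \<open>\<alpha>\<^sub>\<omega>\<close>, which can be transported there.
  For \<open>0 < i < \<omega>\<close> the projection \<open>A\<^sub>\<omega> \<rightarrow> A\<^sub>i\<close> is a split epimorphism: if \<open>A1\<close> is
  empty, so is \<open>A\<^sub>i\<close>; otherwise a point of \<open>A1\<close> is a coalgebra on \<open>1\<close>, which yields a
  point of \<open>A\<^sub>\<omega>\<close> and hence a section at stage \<open>0\<close>, and \<open>A\<close> carries a section at stage \<open>i\<close>
  to one at stage \<open>i + 1\<close>. With a section \<open>s\<close>, the component at \<open>i\<close> must be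
  \<open>B\<^sub>\<omega>\<^sub>,\<^sub>i \<circ> \<alpha>\<^sub>\<omega> \<circ> Fs\<close>, and causality of \<open>\<alpha>\<^sub>\<omega>\<close> says precisely that this choice is
  natural. At stage \<open>0\<close> the target \<open>B\<^sub>0 = 1\<close> leaves no choice.
\<close>

section \<open>Limits and natural transformations in elementary terms\<close>

lemma compose_eq_compose_iff:
  "compose X g f = compose X g' f' \<longleftrightarrow> (\<forall>x \<in> X. g (f x) = g' (f' x))"
  by (auto simp: compose_def fun_eq_iff)

text \<open>An element of \<open>L\<close> is a map into \<open>L\<close> from the one-element set
  \<open>osucc ozero\<close>. Two elements with the same projections induce the same cone on that
  set, so the uniqueness half of the universal property identifies them.\<close>

lemma is_limit_Sets_eqI:
  fixes D :: "('o, 'm, 'v::zf_universe, 'v \<Rightarrow> 'v) funct"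
  assumes lim: "is_limit J Sets D L \<pi>"
    and x: "x \<in> elts L" and y: "y \<in> elts L"
    and eq: "\<And>i. i \<in> Obj J \<Longrightarrow> \<pi> i x = \<pi> i y"
  shows "x = y"
proof -
  let ?X = "osucc ozero :: 'v"
  let ?c = "\<lambda>z. \<lambda>_ \<in> {ozero :: 'v}. z"
  have cone: "is_cone J Sets D L \<pi>" using lim by (simp add: is_limit_def)
  have pi: "\<pi> i \<in> elts L \<rightarrow>\<^sub>E elts (FObj D i)" if "i \<in> Obj J" for i
    using cone that by (simp add: is_cone_def Sets_def)
  have "is_cone J Sets D ?X (\<lambda>i. ?c (\<pi> i x))"
  proof -
    have "FArr D i j u (\<pi> i x) = \<pi> j x" if "i \<in> Obj J" "j \<in> Obj J" "u \<in> Hom J i j" for i j u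
    proof -
      have "compose (elts L) (FArr D i j u) (\<pi> i) = \<pi> j"
        using cone that by (simp add: is_cone_def Sets_def)
      then show ?thesis using x by (metis compose_eq)
    qed
    moreover have "\<pi> i x \<in> elts (FObj D i)" if "i \<in> Obj J" for i
      using pi[OF that] x by blast
    ultimately show ?thesis by (auto simp: is_cone_def Sets_def compose_def fun_eq_iff)
  qed
  then have "\<exists>!h. h \<in> Hom Sets ?X L \<and> (\<forall>i \<in> Obj J. Comp Sets ?X L (FObj D i) (\<pi> i) h = ?c (\<pi> i x))"
    using lim by (simp add: is_limit_def)
  moreover have "?c z \<in> Hom Sets ?X L \<and>
      (\<forall>i \<in> Obj J. Comp Sets ?X L (FObj D i) (\<pi> i) (?c z) = ?c (\<pi> i x))"
    if "z = x \<or> z = y" for z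
    using that x y eq by (auto simp: Sets_def compose_def fun_eq_iff)
  ultimately have "?c x = ?c y" by blast
  then show ?thesis by (metis restrict_apply' singletonI)
qed

text \<open>A compatible family is a cone on the one-element set \<open>osucc ozero\<close>; the
  existence half of the universal property gives a map out of it, whose value is the required
  element.\<close>

lemma is_limit_Sets_lift:
  fixes D :: "('o, 'm, 'v::zf_universe, 'v \<Rightarrow> 'v) funct"
  assumes lim: "is_limit J Sets D L \<pi>"
    and t: "\<And>i. i \<in> Obj J \<Longrightarrow> t i \<in> elts (FObj D i)"
    and comp: "\<And>i j u. i \<in> Obj J \<Longrightarrow> j \<in> Obj J \<Longrightarrow> u \<in> Hom J i j \<Longrightarrow> FArr D i j u (t i) = t j"
  obtains x where "x \<in> elts L" "\<And>i. i \<in> Obj J \<Longrightarrow> \<pi> i x = t i"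
proof -
  let ?X = "osucc ozero :: 'v"
  have "is_cone J Sets D ?X (\<lambda>i. \<lambda>_ \<in> {ozero}. t i)"
    using t comp by (auto simp: is_cone_def Sets_def compose_def fun_eq_iff)
  then obtain h where h: "h \<in> Hom Sets ?X L"
    "\<And>i. i \<in> Obj J \<Longrightarrow> Comp Sets ?X L (FObj D i) (\<pi> i) h = (\<lambda>_ \<in> {ozero}. t i)"
    using lim unfolding is_limit_def by blast
  show thesis
  proof
    show "h ozero \<in> elts L" using h(1) by (auto simp: Sets_def)
    show "\<pi> i (h ozero) = t i" if "i \<in> Obj J" for i
      using fun_cong[OF h(2)[OF that], of ozero] by (simp add: Sets_def compose_def)
  qed
qed

text \<open>A limit only depends on the diagram and the legs over objects and arrows of
  \<open>J\<close>. This permits passing between a final sequence and its restriction to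
  \<omega>.\<close>

lemma is_limit_cong:
  assumes obj: "\<And>i. i \<in> Obj J \<Longrightarrow> FObj D i = FObj E i"
    and arr: "\<And>i j u. i \<in> Obj J \<Longrightarrow> j \<in> Obj J \<Longrightarrow> u \<in> Hom J i j \<Longrightarrow> FArr D i j u = FArr E i j u"
    and leg: "\<And>i. i \<in> Obj J \<Longrightarrow> \<pi> i = \<rho> i"
    and lim: "is_limit J C D L \<pi>"
  shows "is_limit J C E L \<rho>"
proof -
  have cone: "is_cone J C D X \<xi> \<longleftrightarrow> is_cone J C E X \<xi>" for X \<xi>
    unfolding is_cone_def using obj arr by (auto cong: ball_cong)
  have "is_cone J C D L \<pi> \<longleftrightarrow> is_cone J C D L \<rho>"
    unfolding is_cone_def using leg by (auto cong: ball_cong)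
  moreover have "(\<forall>i \<in> Obj J. Comp C X L (FObj D i) (\<pi> i) h = \<xi> i) \<longleftrightarrow>
      (\<forall>i \<in> Obj J. Comp C X L (FObj E i) (\<rho> i) h = \<xi> i)" for X h \<xi>
    using obj leg by (auto cong: ball_cong)
  ultimately show ?thesis using lim unfolding is_limit_def cone by simp
qed

section \<open>Functors, naturality and causality on elements\<close>

lemma is_functor_functor_comp:
  assumes C: "is_category C" and F: "is_functor C D F" and G: "is_functor D E G"
  shows "is_functor C E (functor_comp C G F)"
proof -
  have "Comp C x y z g f \<in> Hom C x z"
    if "x \<in> Obj C" "y \<in> Obj C" "z \<in> Obj C" "f \<in> Hom C x y" "g \<in> Hom C y z" for x y z f g
    using C that unfolding is_category_def by blast
  moreover have "Id C x \<in> Hom C x x" if "x \<in> Obj C" for x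
    using C that unfolding is_category_def by blast
  ultimately show ?thesis
    using F G unfolding is_functor_def functor_comp_def by simp
qed

lemma is_category_Ord_op: "is_category (Ord_op :: ('v::zf_universe, unit) category)"
  unfolding is_category_def Ord_op_def ord_op_on_def by (auto split: if_splits)

lemma functor_Sets_apply_mem:
  fixes F :: "'v::zf_universe endofunctor"
  assumes "is_functor Sets Sets F" "f \<in> elts X \<rightarrow>\<^sub>E elts Y" "x \<in> elts (FObj F X)"
  shows "FArr F X Y f x \<in> elts (FObj F Y)"
  using A_hom[OF assms(1,2)] assms(3) by blast

lemma functor_Sets_cancel:
  fixes F :: "'v::zf_universe endofunctor"
  assumes F: "is_functor Sets Sets F"
    and f: "f \<in> elts X \<rightarrow>\<^sub>E elts Y" and g: "g \<in> elts Y \<rightarrow>\<^sub>E elts X"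
    and gf: "\<And>x. x \<in> elts X \<Longrightarrow> g (f x) = x"
    and x: "x \<in> elts (FObj F X)"
  shows "FArr F Y X g (FArr F X Y f x) = x"
proof -
  have "compose (elts X) g f = (\<lambda>x \<in> elts X. x)"
    using gf by (auto simp: compose_def)
  then show ?thesis using A_comp[OF F f g x] A_id[OF F] x by simp
qed

text \<open>Functors preserve isomorphisms: the image of the inverse map is inverse to the image of
  \<open>f\<close>.\<close>

lemma functor_Sets_bij_betw:
  fixes F :: "'v::zf_universe endofunctor"
  assumes F: "is_functor Sets Sets F"
    and f: "f \<in> elts X \<rightarrow>\<^sub>E elts Y" and bij: "bij_betw f (elts X) (elts Y)"
  shows "bij_betw (FArr F X Y f) (elts (FObj F X)) (elts (FObj F Y))"
proof -
  \<comment> \<open>The inverse is restricted to \<open>elts Y\<close> because arrows of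
    \<open>Sets\<close> are extensional functions.\<close>
  let ?g = "\<lambda>y \<in> elts Y. inv_into (elts X) f y"
  have g: "?g \<in> elts Y \<rightarrow>\<^sub>E elts X"
    using bij by (auto simp: bij_betw_def intro: inv_into_into)
  have gf: "?g (f x) = x" if "x \<in> elts X" for x
    using that f bij_betw_inv_into_left[OF bij that] by auto
  have fg: "f (?g y) = y" if "y \<in> elts Y" for y
    using that bij_betw_inv_into_right[OF bij that] by simp
  show ?thesis
    by (rule bij_betw_byWitness[where f' = "FArr F Y X ?g"])
      (use functor_Sets_cancel[OF F f g gf] functor_Sets_cancel[OF F g f fg]
        functor_Sets_apply_mem[OF F f] functor_Sets_apply_mem[OF F g] in blast)+
qed

lemma nat_trans_Ord_op_iff:
  fixes F :: "'v::zf_universe endofunctor"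
  assumes F: "is_functor Sets Sets F" and S: "is_functor Ord_op Sets S" and T: "is_functor Ord_op Sets T"
  shows "nat_trans Ord_op Sets (functor_comp Ord_op F S) T \<alpha> \<longleftrightarrow>
    (\<forall>i. ordinal i \<longrightarrow> \<alpha> i \<in> elts (FObj F (FObj S i)) \<rightarrow>\<^sub>E elts (FObj T i)) \<and>
    (\<forall>i j. ordinal i \<longrightarrow> ordinal j \<longrightarrow> elts i \<subseteq> elts j \<longrightarrow> (\<forall>x \<in> elts (FObj F (FObj S j)).
      \<alpha> i (FArr F (FObj S j) (FObj S i) (FArr S j i ()) x) = FArr T j i () (\<alpha> j x))) \<and>
    \<alpha> \<in> extensional {i. ordinal i}"
proof -
  have "is_functor Ord_op Sets (functor_comp Ord_op F S)"
    by (rule is_functor_functor_comp[OF is_category_Ord_op S F])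
  then show ?thesis
    using T unfolding nat_trans_def
    by (auto simp: functor_comp_def Ord_op_def ord_op_on_def Sets_def compose_eq_compose_iff)
qed

lemma causal_operation_iff:
  fixes F :: "'v::zf_universe endofunctor"
  assumes F: "is_functor Sets Sets F"
  shows "causal_operation F S T a \<longleftrightarrow>
    a \<in> elts (FObj F (FObj S omega)) \<rightarrow>\<^sub>E elts (FObj T omega) \<and>
    (\<forall>X. \<forall>f \<in> elts X \<rightarrow>\<^sub>E elts (FObj S omega). \<forall>g \<in> elts X \<rightarrow>\<^sub>E elts (FObj S omega). \<forall>i \<in> elts omega.
      (\<forall>x \<in> elts X. FArr S omega i () (f x) = FArr S omega i () (g x)) \<longrightarrow>
      (\<forall>x \<in> elts (FObj F X). FArr T omega i () (a (FArr F X (FObj S omega) f x)) =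
        FArr T omega i () (a (FArr F X (FObj S omega) g x))))"
  unfolding causal_operation_def Sets_def by (simp add: compose_eq compose_eq_compose_iff)

section \<open>Natural transformations and isomorphisms of categories\<close>

lemma is_functor_obj: "is_functor C D F \<Longrightarrow> x \<in> Obj C \<Longrightarrow> FObj F x \<in> Obj D"
  unfolding is_functor_def by blast

lemma is_functor_arr:
  "is_functor C D F \<Longrightarrow> x \<in> Obj C \<Longrightarrow> y \<in> Obj C \<Longrightarrow> f \<in> Hom C x y \<Longrightarrow>
    FArr F x y f \<in> Hom D (FObj F x) (FObj F y)"
  unfolding is_functor_def by blast

lemma is_category_Sets: "is_category Sets"
  unfolding is_category_def Sets_def
  by (auto simp: compose_def fun_eq_iff)

lemma nat_trans_id:
  assumes D: "is_category D" and F: "is_functor C D F"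
  shows "nat_trans C D F F (nat_id C D F)"
proof -
  have obj: "FObj F x \<in> Obj D" if "x \<in> Obj C" for x
    using F that by (simp_all add: is_functor_obj is_functor_arr)
  have arr: "FArr F x y f \<in> Hom D (FObj F x) (FObj F y)"
    if "x \<in> Obj C" "y \<in> Obj C" "f \<in> Hom C x y" for x y f
    using F that by (simp_all add: is_functor_obj is_functor_arr)
  have "Id D a \<in> Hom D a a" if "a \<in> Obj D" for a
    using D that unfolding is_category_def by blast
  moreover have "Comp D a b b (Id D b) g = g" "Comp D a a b g (Id D a) = g"
    if "a \<in> Obj D" "b \<in> Obj D" "g \<in> Hom D a b" for a b g
    using D that unfolding is_category_def by blast+
  ultimately show ?thesis
    unfolding nat_trans_def nat_id_def using F obj arr by simp
qed

lemma nat_trans_comp: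
  assumes D: "is_category D" and \<sigma>: "nat_trans C D F G \<sigma>" and \<tau>: "nat_trans C D G H \<tau>"
  shows "nat_trans C D F H (nat_comp C D F G H \<tau> \<sigma>)"
proof -
  have F: "is_functor C D F" and G: "is_functor C D G" and H: "is_functor C D H"
    using \<sigma> \<tau> by (auto simp: nat_trans_def)
  have obj: "FObj F x \<in> Obj D" "FObj G x \<in> Obj D" "FObj H x \<in> Obj D" if "x \<in> Obj C" for x
    using F G H that by (simp_all add: is_functor_obj is_functor_arr)
  have arr: "FArr F x y f \<in> Hom D (FObj F x) (FObj F y)" "FArr G x y f \<in> Hom D (FObj G x) (FObj G y)"
      "FArr H x y f \<in> Hom D (FObj H x) (FObj H y)"
    if "x \<in> Obj C" "y \<in> Obj C" "f \<in> Hom C x y" for x y f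
    using F G H that by (simp_all add: is_functor_obj is_functor_arr)
  have s: "\<sigma> x \<in> Hom D (FObj F x) (FObj G x)" and t: "\<tau> x \<in> Hom D (FObj G x) (FObj H x)"
    if "x \<in> Obj C" for x
    using \<sigma> \<tau> that unfolding nat_trans_def by blast+
  have cl: "Comp D a b c g f \<in> Hom D a c"
    if "a \<in> Obj D" "b \<in> Obj D" "c \<in> Obj D" "f \<in> Hom D a b" "g \<in> Hom D b c" for a b c f g
    using D that unfolding is_category_def by blast
  have assoc: "Comp D a b d (Comp D b c d h g) f = Comp D a c d h (Comp D a b c g f)"
    if "a \<in> Obj D" "b \<in> Obj D" "c \<in> Obj D" "d \<in> Obj D"
      "f \<in> Hom D a b" "g \<in> Hom D b c" "h \<in> Hom D c d" for a b c d f g h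
    using D that unfolding is_category_def by blast
  have "Comp D (FObj F x) (FObj F y) (FObj H y)
        (Comp D (FObj F y) (FObj G y) (FObj H y) (\<tau> y) (\<sigma> y)) (FArr F x y f) =
      Comp D (FObj F x) (FObj H x) (FObj H y) (FArr H x y f)
        (Comp D (FObj F x) (FObj G x) (FObj H x) (\<tau> x) (\<sigma> x))"
    (is "?l = ?r") if xy: "x \<in> Obj C" "y \<in> Obj C" "f \<in> Hom C x y" for x y f
  proof -
    have "?l = Comp D (FObj F x) (FObj G y) (FObj H y) (\<tau> y)
        (Comp D (FObj F x) (FObj F y) (FObj G y) (\<sigma> y) (FArr F x y f))"
      by (rule assoc) (simp_all add: obj arr s t xy)
    also have "Comp D (FObj F x) (FObj F y) (FObj G y) (\<sigma> y) (FArr F x y f) =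
        Comp D (FObj F x) (FObj G x) (FObj G y) (FArr G x y f) (\<sigma> x)"
      using \<sigma> xy unfolding nat_trans_def by blast
    also have "Comp D (FObj F x) (FObj G y) (FObj H y) (\<tau> y) \<dots> =
        Comp D (FObj F x) (FObj G x) (FObj H y)
          (Comp D (FObj G x) (FObj G y) (FObj H y) (\<tau> y) (FArr G x y f)) (\<sigma> x)"
      by (rule assoc[symmetric]) (simp_all add: obj arr s t xy)
    also have "Comp D (FObj G x) (FObj G y) (FObj H y) (\<tau> y) (FArr G x y f) =
        Comp D (FObj G x) (FObj H x) (FObj H y) (FArr H x y f) (\<tau> x)"
      using \<tau> xy unfolding nat_trans_def by blast
    also have "Comp D (FObj F x) (FObj G x) (FObj H y) \<dots> (\<sigma> x) = ?r"
      by (rule assoc) (simp_all add: obj arr s t xy)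
    finally show ?thesis .
  qed
  then show ?thesis
    unfolding nat_trans_def nat_comp_def using F H obj s t cl by simp
qed

lemma nat_trans_whisker:
  assumes C: "is_category C" and \<kappa>: "nat_trans D E F G \<kappa>" and S: "is_functor C D S"
  shows "nat_trans C E (functor_comp C F S) (functor_comp C G S) (whisker C \<kappa> S)"
proof -
  have F: "is_functor D E F" and G: "is_functor D E G"
    using \<kappa> by (auto simp: nat_trans_def)
  have obj: "FObj S x \<in> Obj D" if "x \<in> Obj C" for x
    using S that by (simp_all add: is_functor_obj is_functor_arr)
  have arr: "FArr S x y f \<in> Hom D (FObj S x) (FObj S y)"
    if "x \<in> Obj C" "y \<in> Obj C" "f \<in> Hom C x y" for x y f
    using S that by (simp_all add: is_functor_obj is_functor_arr)
  have "\<kappa> x \<in> Hom E (FObj F x) (FObj G x)" if "x \<in> Obj D" for x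
    using \<kappa> that unfolding nat_trans_def by blast
  moreover have "Comp E (FObj F x) (FObj F y) (FObj G y) (\<kappa> y) (FArr F x y f) =
      Comp E (FObj F x) (FObj G x) (FObj G y) (FArr G x y f) (\<kappa> x)"
    if "x \<in> Obj D" "y \<in> Obj D" "f \<in> Hom D x y" for x y f
    using \<kappa> that unfolding nat_trans_def by blast
  ultimately show ?thesis
    using is_functor_functor_comp[OF C S F] is_functor_functor_comp[OF C S G] obj arr
    unfolding nat_trans_def by (simp add: functor_comp_def whisker_def)
qed

text \<open>The isomorphism relabels objects along \<open>\<phi>\<close> and keeps every arrow. The
  category axioms for \<open>K\<close> are then those of \<open>C\<close> read through
  \<open>\<phi>\<close>, so they need to be verified for \<open>C\<close> only.\<close>

lemma isomorphic_categoriesI: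
  assumes C: "is_category C" and \<phi>: "bij_betw \<phi> (Obj K) (Obj C)"
    and hom: "\<And>x y. x \<in> Obj K \<Longrightarrow> y \<in> Obj K \<Longrightarrow> Hom K x y = Hom C (\<phi> x) (\<phi> y)"
    and ident: "\<And>x. x \<in> Obj K \<Longrightarrow> Id K x = Id C (\<phi> x)"
    and comp: "\<And>x y z. x \<in> Obj K \<Longrightarrow> y \<in> Obj K \<Longrightarrow> z \<in> Obj K \<Longrightarrow>
      Comp K x y z = Comp C (\<phi> x) (\<phi> y) (\<phi> z)"
  shows "isomorphic_categories C K"
proof -
  let ?\<psi> = "inv_into (Obj K) \<phi>"
  have phi: "\<phi> x \<in> Obj C" "?\<psi> (\<phi> x) = x" if "x \<in> Obj K" for x
    using that \<phi> bij_betw_inv_into_left[OF \<phi> that] by (auto simp: bij_betw_def)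
  have psi: "?\<psi> x \<in> Obj K" "\<phi> (?\<psi> x) = x" if "x \<in> Obj C" for x
    using that \<phi> bij_betw_inv_into_right[OF \<phi> that] by (auto simp: bij_betw_def intro: inv_into_into)
  have cid: "Id C x \<in> Hom C x x" if "x \<in> Obj C" for x
    using C that unfolding is_category_def by blast
  have ccl: "Comp C a b c g f \<in> Hom C a c"
    if "a \<in> Obj C" "b \<in> Obj C" "c \<in> Obj C" "f \<in> Hom C a b" "g \<in> Hom C b c" for a b c f g
    using C that unfolding is_category_def by blast
  have cun: "Comp C a a b f (Id C a) = f" "Comp C a b b (Id C b) f = f"
    if "a \<in> Obj C" "b \<in> Obj C" "f \<in> Hom C a b" for a b f
    using C that unfolding is_category_def by blast+
  have cas: "Comp C a b d (Comp C b c d h g) f = Comp C a c d h (Comp C a b c g f)"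
    if "a \<in> Obj C" "b \<in> Obj C" "c \<in> Obj C" "d \<in> Obj C"
      "f \<in> Hom C a b" "g \<in> Hom C b c" "h \<in> Hom C c d" for a b c d f g h
    using C that unfolding is_category_def by blast
  have K: "is_category K"
    unfolding is_category_def
    using phi(1) cid ccl cun cas by (simp add: hom ident comp)
  \<comment> \<open>\<open>P\<close> and \<open>Q\<close> act as \<open>\<phi>\<close> and its
    inverse on objects and as the identity on arrows. The value \<open>undefined\<close> elsewhere
    is what \<open>is_functor\<close> demands.\<close>
  define P where "P = \<lparr>FObj = (\<lambda>x. if x \<in> Obj K then \<phi> x else undefined),
    FArr = (\<lambda>x y f. if x \<in> Obj K \<and> y \<in> Obj K \<and> f \<in> Hom K x y then f else undefined)\<rparr>"
  define Q where "Q = \<lparr>FObj = (\<lambda>x. if x \<in> Obj C then ?\<psi> x else undefined),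
    FArr = (\<lambda>x y f. if x \<in> Obj C \<and> y \<in> Obj C \<and> f \<in> Hom C x y then f else undefined)\<rparr>"
  have "is_functor K C P"
    unfolding is_functor_def P_def using phi cid ccl by (auto simp: hom ident comp)
  moreover have "is_functor C K Q"
    unfolding is_functor_def Q_def using psi cid ccl by (auto simp: hom ident comp)
  moreover have "functor_comp C P Q = functor_id C"
    unfolding functor_comp_def functor_id_def P_def Q_def
    using psi by (auto simp: hom fun_eq_iff)
  moreover have "functor_comp K Q P = functor_id K"
    unfolding functor_comp_def functor_id_def P_def Q_def
    using phi by (auto simp: hom fun_eq_iff)
  ultimately show ?thesis using C K unfolding isomorphic_categories_def by blast
qed


section \<open>Final sequences of continuous functors\<close>

lemma omega_cases:
  assumes "i \<in> elts omega"
  obtains "i = ozero" | k where "k \<in> elts omega" "i = osucc k"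
proof -
  obtain n where n: "i = (osucc ^^ n) ozero" using assms by (auto simp: elts_omega)
  show thesis
  proof (cases n)
    case 0
    then show ?thesis using n that(1) by simp
  next
    case (Suc m)
    then show ?thesis using n that(2)[of "(osucc ^^ m) ozero"] by (simp add: elts_omega)
  qed
qed

lemma ordinal_omega: "ordinal omega"
  using limit_ordinal_omega unfolding limit_ordinal_def by blast

lemma omega_dichotomy: "ordinal i \<Longrightarrow> i \<in> elts omega \<or> elts omega \<subseteq> elts i"
  using ordinal_linear[OF _ ordinal_omega, of i] ordinal_subset by blast

lemma subset_osucc: "elts i \<subseteq> elts (osucc i)"
  by auto

lemma osucc_mono: "ordinal i \<Longrightarrow> ordinal j \<Longrightarrow> elts i \<subseteq> elts j \<Longrightarrow> elts (osucc i) \<subseteq> elts (osucc j)"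
  using ordinal_le_iff[of i j] by auto

section \<open>Connecting maps and limit stages on elements\<close>

locale omega_sequence =
  fixes A :: "'v::zf_universe endofunctor" and S :: "'v ord_diagram"
  assumes endofunctor: "is_functor Sets Sets A"
    and continuous: "omega_continuous A"
    and final: "final_sequence A S"
begin

lemma diagram: "is_functor Ord_op Sets S"
  using final unfolding final_sequence_def by blast

lemma elts_zero: "elts (FObj S ozero) = {ozero}"
proof -
  have "FObj S ozero = osucc ozero" using final unfolding final_sequence_def by blast
  then show ?thesis by simp
qed

lemma obj_succ: "ordinal i \<Longrightarrow> FObj S (osucc i) = FObj A (FObj S i)"
  using final unfolding final_sequence_def by blast

lemma arr_succ:
  "ordinal i \<Longrightarrow> ordinal j \<Longrightarrow> elts i \<subseteq> elts j \<Longrightarrow>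
    FArr S (osucc j) (osucc i) () = FArr A (FObj S j) (FObj S i) (FArr S j i ())"
  using final unfolding final_sequence_def by blast

lemma arr_hom:
  assumes "ordinal i" "ordinal j" "elts i \<subseteq> elts j"
  shows "FArr S j i () \<in> elts (FObj S j) \<rightarrow>\<^sub>E elts (FObj S i)"
proof -
  have *: "i \<in> Obj Ord_op" "j \<in> Obj Ord_op" "() \<in> Hom Ord_op j i"
    using assms by (auto simp: Ord_op_def ord_op_on_def)
  have "FArr S j i () \<in> Hom Sets (FObj S j) (FObj S i)"
    using diagram * unfolding is_functor_def by blast
  then show ?thesis by (simp add: Sets_def)
qed

lemma arr_mem:
  "ordinal i \<Longrightarrow> ordinal j \<Longrightarrow> elts i \<subseteq> elts j \<Longrightarrow> x \<in> elts (FObj S j) \<Longrightarrow>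
    FArr S j i () x \<in> elts (FObj S i)"
  using arr_hom[of i j] by blast

lemma arr_id:
  assumes "ordinal i" "x \<in> elts (FObj S i)"
  shows "FArr S i i () x = x"
proof -
  have *: "i \<in> Obj Ord_op"
    using assms by (auto simp: Ord_op_def ord_op_on_def)
  have "FArr S i i (Id Ord_op i) = Id Sets (FObj S i)"
    using diagram * unfolding is_functor_def by blast
  then show ?thesis using assms(2) by (simp add: Sets_def)
qed

lemma compose_arr:
  assumes "ordinal i" "ordinal j" "ordinal k" "elts i \<subseteq> elts j" "elts j \<subseteq> elts k"
  shows "compose (elts (FObj S k)) (FArr S j i ()) (FArr S k j ()) = FArr S k i ()"
proof -
  have "i \<in> Obj Ord_op" "j \<in> Obj Ord_op" "k \<in> Obj Ord_op" "() \<in> Hom Ord_op k j" "() \<in> Hom Ord_op j i"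
    using assms by (auto simp: Ord_op_def ord_op_on_def)
  then have "FArr S k i (Comp Ord_op k j i () ()) =
      Comp Sets (FObj S k) (FObj S j) (FObj S i) (FArr S j i ()) (FArr S k j ())"
    using diagram unfolding is_functor_def by blast
  then show ?thesis by (simp add: Sets_def)
qed

lemma arr_comp:
  assumes "ordinal i" "ordinal j" "ordinal k" "elts i \<subseteq> elts j" "elts j \<subseteq> elts k"
    and "x \<in> elts (FObj S k)"
  shows "FArr S j i () (FArr S k j () x) = FArr S k i () x"
  using compose_arr[OF assms(1-5)] assms(6) by (metis compose_eq)

lemma limit:
  "limit_ordinal j \<Longrightarrow> is_limit (below_op j) Sets S (FObj S j) (\<lambda>i. FArr S j i ())"
  using final unfolding final_sequence_def by blast

lemma limit_eqI:
  assumes "limit_ordinal j" "x \<in> elts (FObj S j)" "y \<in> elts (FObj S j)"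
    and "\<And>i. i \<in> elts j \<Longrightarrow> FArr S j i () x = FArr S j i () y"
  shows "x = y"
  using is_limit_Sets_eqI[OF limit[OF assms(1)] assms(2,3)] assms(4)
  by (simp add: below_op_def ord_op_on_def)

lemma limit_lift:
  assumes "limit_ordinal j" "\<And>i. i \<in> elts j \<Longrightarrow> t i \<in> elts (FObj S i)"
    and "\<And>i k. i \<in> elts j \<Longrightarrow> k \<in> elts j \<Longrightarrow> elts k \<subseteq> elts i \<Longrightarrow> FArr S i k () (t i) = t k"
  obtains x where "x \<in> elts (FObj S j)" "\<And>i. i \<in> elts j \<Longrightarrow> FArr S j i () x = t i"
proof -
  obtain x where "x \<in> elts (FObj S j)" "\<And>i. i \<in> Obj (below_op j) \<Longrightarrow> FArr S j i () x = t i"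
    by (rule is_limit_Sets_lift[OF limit[OF assms(1)], of t])
      (use assms in \<open>auto simp: below_op_def ord_op_on_def split: if_splits\<close>)
  then show thesis using that by (simp add: below_op_def ord_op_on_def)
qed

text \<open>
  Continuity is only available for diagrams that are \<open>undefined\<close> outside \<open>\<omega>\<close>,
  so \<open>S\<close> has to be cut down first.
\<close>

lemma functor_limit_omega:
  "\<exists>D. (\<forall>i \<in> elts omega. FObj D i = FObj A (FObj S i)) \<and>
    (\<forall>i \<in> elts omega. \<forall>j \<in> elts omega. elts i \<subseteq> elts j \<longrightarrow>
      FArr D j i () = FArr A (FObj S j) (FObj S i) (FArr S j i ())) \<and>
    is_limit (below_op omega) Sets D (FObj A (FObj S omega))
      (\<lambda>i. FArr A (FObj S omega) (FObj S i) (FArr S omega i ()))"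
proof -
  define D :: "'v ord_diagram" where "D =
    \<lparr>FObj = (\<lambda>i. if i \<in> elts omega then FObj S i else undefined),
     FArr = (\<lambda>j i u. if j \<in> elts omega \<and> i \<in> elts omega \<and> elts i \<subseteq> elts j
        then FArr S j i () else undefined)\<rparr>"
  have o: "ordinal i" if "i \<in> elts omega" for i :: 'v
    using that ordinal_omega ordinal_mem by blast
  have "is_functor (below_op omega) Sets D"
  proof -
    have "(\<lambda>x \<in> elts (FObj S i). x) = FArr S i i ()" if "ordinal i" for i
      using arr_id[OF that] arr_hom[OF that that] by (auto simp: fun_eq_iff PiE_def extensional_def)
    then show ?thesis
      using o arr_hom compose_arr
      by (auto simp: is_functor_def D_def below_op_def ord_op_on_def Sets_def split: if_splits)
  qed
  moreover have "is_limit (below_op omega) Sets D (FObj S omega) (\<lambda>i. FArr S omega i ())"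
    by (rule is_limit_cong[OF _ _ _ limit[OF limit_ordinal_omega]])
      (auto simp: D_def below_op_def ord_op_on_def split: if_splits)
  ultimately have l: "is_limit (below_op omega) Sets (functor_comp (below_op omega) A D)
      (FObj A (FObj S omega)) (\<lambda>i. FArr A (FObj S omega) (FObj D i) (FArr S omega i ()))"
    using continuous unfolding omega_continuous_def by blast
  have D: "FObj D i = FObj S i" if "i \<in> elts omega" for i using that by (simp add: D_def)
  have "is_limit (below_op omega) Sets (functor_comp (below_op omega) A D)
      (FObj A (FObj S omega)) (\<lambda>i. FArr A (FObj S omega) (FObj S i) (FArr S omega i ()))"
    by (rule is_limit_cong[OF _ _ _ l]) (simp_all add: below_op_def ord_op_on_def D)
  moreover have "FObj (functor_comp (below_op omega) A D) i = FObj A (FObj S i)"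
    if "i \<in> elts omega" for i
    using that by (simp add: functor_comp_def D_def below_op_def ord_op_on_def)
  moreover have "FArr (functor_comp (below_op omega) A D) j i () =
      FArr A (FObj S j) (FObj S i) (FArr S j i ())"
    if "i \<in> elts omega" "j \<in> elts omega" "elts i \<subseteq> elts j" for i j
    using that by (simp add: functor_comp_def D_def below_op_def ord_op_on_def)
  ultimately show ?thesis by blast
qed

section \<open>Stabilisation from stage \<omega> on\<close>

text \<open>By continuity, \<open>A\<close> applied to stage \<omega> is the limit of the chain of
  stages \<open>osucc i\<close>. That is the original chain without stage 0, so it has the same
  limit, and the connecting map is the comparison between the two.\<close>

lemma bij_betw_succ_omega:
  "bij_betw (FArr S (osucc omega) omega ()) (elts (FObj S (osucc omega))) (elts (FObj S omega))"
proof -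
  let ?m = "FArr S (osucc omega) omega ()"
  let ?L = "FObj A (FObj S omega)"
  let ?p = "\<lambda>i. FArr A (FObj S omega) (FObj S i) (FArr S omega i ())"
  note ow = ordinal_omega ordinal_osucc[OF ordinal_omega]
  have o: "ordinal i" "elts i \<subseteq> elts omega" "osucc i \<in> elts omega" "ordinal (osucc i)"
      "elts (osucc i) \<subseteq> elts omega"
    if "i \<in> elts omega" for i :: 'v
  proof -
    show *: "osucc i \<in> elts omega" by (rule limit_osucc[OF limit_ordinal_omega that])
    show "ordinal i" "elts i \<subseteq> elts omega" "ordinal (osucc i)" "elts (osucc i) \<subseteq> elts omega"
      using that * ordinal_omega ordinal_mem ordinal_subset by blast+
  qed
  have L: "FObj S (osucc omega) = ?L" by (rule obj_succ[OF ordinal_omega])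
  \<comment> \<open>The index shift: projecting \<open>?m x\<close> to stage \<open>osucc i\<close>
    gives the leg of the continuous limit at \<open>i\<close>.\<close>
  have down: "FArr S omega (osucc i) () (?m x) = ?p i x" if "i \<in> elts omega" "x \<in> elts ?L" for i x
    using arr_comp[of "osucc i" omega "osucc omega" x] arr_succ[of i omega] o[OF that(1)] ow that(2)
    by (simp add: L subset_osucc del: elts_osucc)
  obtain D where D: "\<And>i. i \<in> elts omega \<Longrightarrow> FObj D i = FObj A (FObj S i)"
      "\<And>i j. i \<in> elts omega \<Longrightarrow> j \<in> elts omega \<Longrightarrow> elts i \<subseteq> elts j \<Longrightarrow>
        FArr D j i () = FArr A (FObj S j) (FObj S i) (FArr S j i ())"
      "is_limit (below_op omega) Sets D ?L ?p"
    using functor_limit_omega by blast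
  have "inj_on ?m (elts ?L)"
  proof (rule inj_onI)
    fix x y assume xy: "x \<in> elts ?L" "y \<in> elts ?L" "?m x = ?m y"
    show "x = y"
    proof (rule is_limit_Sets_eqI[OF D(3) xy(1,2)])
      fix i :: 'v assume "i \<in> Obj (below_op omega)"
      then have "i \<in> elts omega" by (simp add: below_op_def ord_op_on_def)
      from down[OF this xy(1)] down[OF this xy(2)] show "?p i x = ?p i y" unfolding xy(3) by simp
    qed
  qed
  moreover have "z \<in> ?m ` elts ?L" if z: "z \<in> elts (FObj S omega)" for z
  proof -
    \<comment> \<open>A preimage of \<open>z\<close> is glued from its projections, shifted by one
      to lie in the diagram \<open>D\<close>.\<close>
    obtain x where x: "x \<in> elts ?L"
      "\<And>i. i \<in> Obj (below_op omega) \<Longrightarrow> ?p i x = FArr S omega (osucc i) () z"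
    proof (rule is_limit_Sets_lift[OF D(3), of "\<lambda>i. FArr S omega (osucc i) () z"])
      fix i :: 'v assume "i \<in> Obj (below_op omega)"
      then show "FArr S omega (osucc i) () z \<in> elts (FObj D i)"
        using o[of i] D(1) arr_mem[OF _ _ _ z, of "osucc i"] ow(1) obj_succ[of i]
        by (simp add: below_op_def ord_op_on_def del: elts_osucc)
    next
      fix j i :: 'v and u assume "j \<in> Obj (below_op omega)" "i \<in> Obj (below_op omega)"
        "u \<in> Hom (below_op omega) j i"
      then have ij: "j \<in> elts omega" "i \<in> elts omega" "elts i \<subseteq> elts j"
        by (auto simp: below_op_def ord_op_on_def split: if_splits)
      then show "FArr D j i u (FArr S omega (osucc j) () z) = FArr S omega (osucc i) () z"
        using arr_comp[of "osucc i" "osucc j" omega z] o[OF ij(1)] o[OF ij(2)] ow z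
          D(2)[OF ij(2,1,3)] arr_succ[of i j] osucc_mono[of i j]
        by (simp del: elts_osucc)
    qed blast
    have mx: "?m x \<in> elts (FObj S omega)"
      using x(1) ow arr_mem[of omega "osucc omega" x] by (simp add: L subset_osucc del: elts_osucc)
    have "?m x = z"
    proof (rule limit_eqI[OF limit_ordinal_omega mx z])
      fix i :: 'v assume i: "i \<in> elts omega"
      \<comment> \<open>\<open>down\<close> controls successor stages only; projecting on from
        \<open>osucc i\<close> to \<open>i\<close> also covers stage 0.\<close>
      have "FArr S omega (osucc i) () (?m x) = FArr S omega (osucc i) () z"
        using down[OF i x(1)] x(2) i by (simp add: below_op_def ord_op_on_def)
      then show "FArr S omega i () (?m x) = FArr S omega i () z"
        using arr_comp[of i "osucc i" omega] o[OF i] ow mx z by (metis subset_osucc)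
    qed
    then show ?thesis using x(1) by blast
  qed
  moreover have "?m x \<in> elts (FObj S omega)" if "x \<in> elts ?L" for x
    using that ow arr_mem[of omega "osucc omega" x] by (simp add: L subset_osucc del: elts_osucc)
  ultimately show ?thesis unfolding L bij_betw_def by blast
qed

text \<open>Transfinite induction. At a successor of \<open>k\<close>, \<open>A\<close> preserves
  the bijection at \<open>k\<close>, and composing with the map from stage
  \<open>osucc omega\<close> to \<omega> reduces to the previous lemma. At a limit above \<omega>,
  the component at \<omega> fixes the components below it by projection and those above it by the
  induction hypothesis.\<close>

lemma bij_betw_omega:
  assumes "ordinal j" "elts omega \<subseteq> elts j"
  shows "bij_betw (FArr S j omega ()) (elts (FObj S j)) (elts (FObj S omega))"
  using assms
proof (induction j rule: mem_induct)
  case (mem j)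
  note ow = ordinal_omega
  show ?case
  proof (cases "j = omega")
    case True
    have "bij_betw (\<lambda>x. x) (elts (FObj S omega)) (elts (FObj S omega))" by (simp add: bij_betw_def)
    then show ?thesis
      unfolding True using arr_id[OF ow] by (subst bij_betw_cong[where g = "\<lambda>x. x"]) auto
  next
    case False
    then have wj: "omega \<in> elts j" using ordinal_le_iff[OF ow mem.prems(1)] mem.prems(2) by auto
    from mem.prems(1) show ?thesis
    proof (cases j rule: ordinal_cases)
      case zero
      then show ?thesis using wj by simp
    next
      case (succ k)
      then have wk: "elts omega \<subseteq> elts k" using wj ordinal_le_iff[OF ow succ(1)] by auto
      have "bij_betw (FArr S k omega ()) (elts (FObj S k)) (elts (FObj S omega))"
        using mem.IH[of k] succ wk by simp
      then have "bij_betw (FArr S j (osucc omega) ()) (elts (FObj S j)) (elts (FObj S (osucc omega)))"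
        using functor_Sets_bij_betw[OF endofunctor arr_hom[OF ow succ(1) wk]]
          arr_succ[OF ow succ(1) wk] obj_succ[OF ow] obj_succ[OF succ(1)] succ(2) by simp
      note b = bij_betw_trans[OF this bij_betw_succ_omega]
      have "elts (osucc omega) \<subseteq> elts j" using osucc_mono[OF ow succ(1) wk] succ(2) by simp
      then have "(FArr S (osucc omega) omega () \<circ> FArr S j (osucc omega) ()) x = FArr S j omega () x"
        if "x \<in> elts (FObj S j)" for x
        using arr_comp[OF ow ordinal_osucc[OF ow] mem.prems(1) subset_osucc _ that] by simp
      then show ?thesis using b by (subst bij_betw_cong) auto
    next
      case limit
      let ?m = "FArr S j omega ()"
      have o: "ordinal i" "elts i \<subseteq> elts j" if "i \<in> elts j" for i
        using that mem.prems(1) ordinal_mem ordinal_subset by blast+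
      have IH: "bij_betw (FArr S i omega ()) (elts (FObj S i)) (elts (FObj S omega))"
        if "i \<in> elts j" "elts omega \<subseteq> elts i" for i
        using mem.IH that o by blast
      have "x = y" if xy: "x \<in> elts (FObj S j)" "y \<in> elts (FObj S j)" "?m x = ?m y" for x y
      proof (rule limit_eqI[OF limit xy(1,2)])
        fix i assume i: "i \<in> elts j"
        \<comment> \<open>Below \<omega> the projection factors through stage \<omega>; from
          \<omega> on, the map back to stage \<omega> is injective by induction.\<close>
        show "FArr S j i () x = FArr S j i () y"
        proof (cases "i \<in> elts omega")
          case True
          then show ?thesis
            using xy arr_comp[of i omega j] o[OF i] ow mem.prems ordinal_subset[OF ow True] by metis
        next
          case False
          then have wi: "elts omega \<subseteq> elts i" using omega_dichotomy o[OF i] by blast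
          have "FArr S i omega () (FArr S j i () x) = FArr S i omega () (FArr S j i () y)"
            using xy arr_comp[of omega i j] o[OF i] ow mem.prems wi by metis
          then show ?thesis
            using IH[OF i wi] arr_mem[of i j] o[OF i] mem.prems xy
            by (meson bij_betw_def inj_onD)
        qed
      qed
      then have "inj_on ?m (elts (FObj S j))" by (auto intro: inj_onI)
      moreover have "z \<in> ?m ` elts (FObj S j)" if z: "z \<in> elts (FObj S omega)" for z
      proof -
        \<comment> \<open>The thread through \<open>z\<close>: its projections below \<omega>, and
          its unique preimages from \<omega> on.\<close>
        define t where "t i = (if i \<in> elts omega then FArr S omega i () z
          else inv_into (elts (FObj S i)) (FArr S i omega ()) z)" for i
        have small: "t i = FArr S omega i () z" if "i \<in> elts omega" for i
          using that by (simp add: t_def)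
        have large: "t i \<in> elts (FObj S i)" "FArr S i omega () (t i) = z"
          if "i \<in> elts j" "elts omega \<subseteq> elts i" for i
        proof -
          have "i \<notin> elts omega" using that(2) mem_irrefl[of i] by blast
          then show "t i \<in> elts (FObj S i)" "FArr S i omega () (t i) = z"
            using IH[OF that] z bij_betw_inv_into_right[OF IH[OF that] z]
            by (auto simp: t_def bij_betw_def intro: inv_into_into)
        qed
        obtain x where x: "x \<in> elts (FObj S j)" "\<And>i. i \<in> elts j \<Longrightarrow> FArr S j i () x = t i"
        proof (rule limit_lift[OF limit, of t])
          fix i assume i: "i \<in> elts j"
          show "t i \<in> elts (FObj S i)"
            using omega_dichotomy[OF o(1)[OF i]] large(1)[OF i] small[of i]
              arr_mem[OF o(1)[OF i] ow ordinal_subset[OF ow] z] by auto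
        next
          fix i k assume i: "i \<in> elts j" and k: "k \<in> elts j" and ki: "elts k \<subseteq> elts i"
          \<comment> \<open>Compatibility depends on where \<omega> lies relative to
            \<open>k\<close> and \<open>i\<close>. If both are at least \<omega>, it is tested after
            the injective map to stage \<omega>.\<close>
          consider "i \<in> elts omega" | "k \<in> elts omega" "elts omega \<subseteq> elts i" | "elts omega \<subseteq> elts k"
            using omega_dichotomy o(1) i k by blast
          then show "FArr S i k () (t i) = t k"
          proof cases
            case 1
            then have "k \<in> elts omega"
              using ki ordinal_le_iff[OF o(1)[OF k] o(1)[OF i]] ordinal_subset[OF ow 1] by blast
            then show ?thesis
              using 1 small arr_comp[OF o(1)[OF k] o(1)[OF i] ow ki ordinal_subset[OF ow 1] z] by simp
          next
            case 2
            then show ?thesis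
              using small[OF 2(1)] large[OF i 2(2)]
                arr_comp[OF o(1)[OF k] ow o(1)[OF i] ordinal_subset[OF ow 2(1)] 2(2)] by metis
          next
            case 3
            then have wi: "elts omega \<subseteq> elts i" using ki by blast
            have "FArr S k omega () (FArr S i k () (t i)) = FArr S k omega () (t k)"
              using arr_comp[OF ow o(1)[OF k] o(1)[OF i] 3 ki] large[OF i wi] large[OF k 3] by metis
            then show ?thesis
              using IH[OF k 3] arr_mem[OF o(1)[OF k] o(1)[OF i] ki large(1)[OF i wi]] large(1)[OF k 3]
              by (meson bij_betw_def inj_onD)
          qed
        qed blast
        \<comment> \<open>Here \<omega> is itself an index below \<open>j\<close>, and the
          connecting map from \<omega> to itself is the identity, so the component of
          \<open>x\<close> there is \<open>z\<close>.\<close>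
        have "?m x = z" using x(2)[OF wj] large(2)[OF wj] arr_id[OF ow] large(1)[OF wj] by simp
        then show ?thesis using x(1) by blast
      qed
      moreover have "?m x \<in> elts (FObj S omega)" if "x \<in> elts (FObj S j)" for x
        using arr_mem[OF ow mem.prems that] .
      ultimately show ?thesis unfolding bij_betw_def by blast
    qed
  qed
qed

section \<open>Sections of the projections from stage \<omega>\<close>

text \<open>
  A point \<open>c\<close> of \<open>A1\<close> is a coalgebra structure on \<open>1\<close>, and \<open>y\<close> below is the
  unique coalgebra-induced point of \<open>A\<^sub>i\<close>.
\<close>

lemma ex1_coalgebra_point:
  assumes c: "c \<in> elts (FObj S (osucc ozero))" and "ordinal i"
  shows "\<exists>!y. y \<in> elts (FObj S i) \<and>
    FArr S (osucc i) i () (FArr A (FObj S ozero) (FObj S i) (\<lambda>_ \<in> elts (FObj S ozero). y) c) = y"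
proof -
  \<comment> \<open>Stage 0 is the one-element set, so \<open>y\<close> is a map from it to stage
    \<open>i\<close>; \<open>q i y\<close> is the image of \<open>c\<close> under \<open>A\<close>
    of that map and lives at stage \<open>osucc i\<close>.\<close>
  define q where "q i y = FArr A (FObj S ozero) (FObj S i) (\<lambda>_ \<in> elts (FObj S ozero). y) c" for i y
  \<comment> \<open>\<open>P i y\<close> states the coalgebra equation as a fixed-point condition at
    stage \<open>i\<close>, which makes sense uniformly at zero, successor and limit stages.\<close>
  define P where "P i y \<longleftrightarrow> y \<in> elts (FObj S i) \<and> FArr S (osucc i) i () (q i y) = y" for i y
  have cA: "c \<in> elts (FObj A (FObj S ozero))" using c obj_succ[OF ordinal_ozero] by simp
  have q_mem: "q i y \<in> elts (FObj S (osucc i))" if "ordinal i" "y \<in> elts (FObj S i)" for i y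
  proof -
    have "(\<lambda>_ \<in> elts (FObj S ozero). y) \<in> elts (FObj S ozero) \<rightarrow>\<^sub>E elts (FObj S i)" using that by auto
    then show ?thesis
      unfolding q_def using functor_Sets_apply_mem[OF endofunctor _ cA] obj_succ[OF that(1)] by simp
  qed
  have q_arr: "FArr S (osucc j) (osucc i) () (q j y) = q i (FArr S j i () y)"
    if "ordinal i" "ordinal j" "elts i \<subseteq> elts j" "y \<in> elts (FObj S j)" for i j y
  proof -
    have "(\<lambda>_ \<in> elts (FObj S ozero). y) \<in> elts (FObj S ozero) \<rightarrow>\<^sub>E elts (FObj S j)" using that by auto
    moreover have "compose (elts (FObj S ozero)) (FArr S j i ()) (\<lambda>_ \<in> elts (FObj S ozero). y) =
        (\<lambda>_ \<in> elts (FObj S ozero). FArr S j i () y)"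
      by (auto simp: compose_def)
    ultimately show ?thesis
      unfolding q_def arr_succ[OF that(1-3)]
      using A_comp[OF endofunctor _ arr_hom[OF that(1-3)] cA] by simp
  qed
  \<comment> \<open>Connecting maps send fixed points to fixed points; together with uniqueness this
    makes the points at different stages compatible.\<close>
  have P_arr: "P i (FArr S j i () y)" if "ordinal i" "ordinal j" "elts i \<subseteq> elts j" "P j y" for i j y
  proof -
    have y: "y \<in> elts (FObj S j)" "FArr S (osucc j) j () (q j y) = y" using that(4) by (auto simp: P_def)
    note qj = q_mem[OF that(2) y(1)]
    have "FArr S (osucc i) i () (q i (FArr S j i () y)) = FArr S (osucc j) i () (q j y)"
      using q_arr[OF that(1-3) y(1)]
        arr_comp[OF that(1) ordinal_osucc[OF that(1)] ordinal_osucc[OF that(2)] subset_osucc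
          osucc_mono[OF that(1-3)] qj] by simp
    also have "\<dots> = FArr S j i () y"
      using arr_comp[OF that(1,2) ordinal_osucc[OF that(2)] that(3) subset_osucc qj] y(2) by simp
    finally show ?thesis using arr_mem[OF that(1-3) y(1)] by (simp add: P_def)
  qed
  have "\<exists>!y. P i y"
    using assms(2)
  proof (induction i rule: mem_induct)
    case (mem i)
    from mem.prems show ?case
    proof (cases i rule: ordinal_cases)
      case zero
      have "FArr S (osucc ozero) ozero () (q ozero ozero) \<in> elts (FObj S ozero)"
        using arr_mem[OF ordinal_ozero ordinal_osucc[OF ordinal_ozero] subset_osucc]
          q_mem[OF ordinal_ozero, of ozero] elts_zero by simp
      then show ?thesis by (auto simp: P_def elts_zero zero)
    next
      case (succ k)
      have kk: "ordinal k" "ordinal i" "elts k \<subseteq> elts i" using succ mem.prems by auto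
      obtain z where z: "P k z" "\<And>z'. P k z' \<Longrightarrow> z' = z" using mem.IH[of k] succ by auto
      have zk: "z \<in> elts (FObj S k)" "FArr S (osucc k) k () (q k z) = z" using z(1) by (auto simp: P_def)
      \<comment> \<open>By naturality of \<open>q\<close>, the equation at stage
        \<open>osucc k\<close> reads \<open>y = q k (FArr S i k () y)\<close>, and the projection of
        \<open>y\<close> to stage \<open>k\<close> must be \<open>z\<close>.\<close>
      have "P i (q k z)"
        using q_mem[OF kk(1) zk(1)] q_arr[OF kk] zk(2) succ(2) by (simp add: P_def)
      moreover have "y = q k z" if "P i y" for y
      proof -
        have "y \<in> elts (FObj S i)" "FArr S (osucc i) i () (q i y) = y" using that by (auto simp: P_def)
        then show ?thesis using q_arr[OF kk, of y] z(2)[OF P_arr[OF kk that]] succ(2) by simp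
      qed
      ultimately show ?thesis by blast
    next
      case limit
      have o: "ordinal k" "elts k \<subseteq> elts i" if "k \<in> elts i" for k
        using that mem.prems ordinal_mem ordinal_subset by blast+
      \<comment> \<open>The unique fixed points below \<open>i\<close>; by \<open>P_arr\<close> and
        uniqueness they form a thread.\<close>
      define t where "t k = (THE y. P k y)" for k
      have t: "P k (t k)" "P k y \<Longrightarrow> y = t k" if "k \<in> elts i" for k y
        using mem.IH[OF that o(1)[OF that]] theI'[of "P k"] unfolding t_def by blast+
      obtain x where x: "x \<in> elts (FObj S i)" "\<And>k. k \<in> elts i \<Longrightarrow> FArr S i k () x = t k"
      proof (rule limit_lift[OF limit, of t])
        show "t k \<in> elts (FObj S k)" if "k \<in> elts i" for k using t(1)[OF that] by (simp add: P_def)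
        show "FArr S j k () (t j) = t k" if "j \<in> elts i" "k \<in> elts i" "elts k \<subseteq> elts j" for j k
          using t(2)[OF that(2) P_arr[OF o(1)[OF that(2)] o(1)[OF that(1)] that(3) t(1)[OF that(1)]]] .
      qed blast
      let ?x = "FArr S (osucc i) i () (q i x)"
      note qi = q_mem[OF mem.prems x(1)]
      \<comment> \<open>The component at \<open>k\<close> is routed through stage
        \<open>osucc k\<close>, where \<open>q_arr\<close> turns the claim into the fixed-point
        equation for \<open>t k\<close>.\<close>
      have "?x = x"
      proof (rule limit_eqI[OF limit _ x(1)])
        show "?x \<in> elts (FObj S i)"
          by (rule arr_mem[OF mem.prems ordinal_osucc[OF mem.prems] subset_osucc qi])
        fix k assume k: "k \<in> elts i"
        note ok = o[OF k]
        have "FArr S i k () ?x = FArr S (osucc i) k () (q i x)"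
          by (rule arr_comp[OF ok(1) mem.prems ordinal_osucc[OF mem.prems] ok(2) subset_osucc qi])
        also have "\<dots> = FArr S (osucc k) k () (FArr S (osucc i) (osucc k) () (q i x))"
          by (rule arr_comp[OF ok(1) ordinal_osucc[OF ok(1)] ordinal_osucc[OF mem.prems] subset_osucc
                osucc_mono[OF ok(1) mem.prems ok(2)] qi, symmetric])
        also have "\<dots> = t k"
          using q_arr[OF ok(1) mem.prems ok(2) x(1)] x(2)[OF k] t(1)[OF k] by (simp add: P_def)
        finally show "FArr S i k () ?x = FArr S i k () x" using x(2)[OF k] by simp
      qed
      then have "P i x" using x(1) by (simp add: P_def)
      moreover have "y = x" if "P i y" for y
      proof (rule limit_eqI[OF limit _ x(1)])
        show "y \<in> elts (FObj S i)" using that by (simp add: P_def)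
        show "FArr S i k () y = FArr S i k () x" if k: "k \<in> elts i" for k
          using t(2)[OF k P_arr[OF o(1)[OF k] mem.prems o(2)[OF k] \<open>P i y\<close>]] x(2)[OF k] by simp
      qed
      ultimately show ?thesis by blast
    qed
  qed
  then show ?thesis unfolding P_def q_def .
qed

text \<open>
  The stage \<open>i = 0\<close> must be excluded: if \<open>A1\<close> is empty, then so are all
  stages except \<open>A\<^sub>0 = 1\<close>.
\<close>

lemma section_omega:
  assumes "i \<in> elts omega" "i \<noteq> ozero"
  obtains s where "s \<in> elts (FObj S i) \<rightarrow>\<^sub>E elts (FObj S omega)"
    "\<And>x. x \<in> elts (FObj S i) \<Longrightarrow> FArr S omega i () (s x) = x"
proof (cases "elts (FObj S (osucc ozero)) = {}")
  case True
  obtain k where k: "k \<in> elts omega" "i = osucc k" using assms omega_cases by blast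
  have ok: "ordinal k" using k(1) ordinal_omega ordinal_mem by blast
  have "elts (osucc ozero) \<subseteq> elts i" unfolding k(2) using osucc_mono[OF ordinal_ozero ok] by simp
  \<comment> \<open>A positive stage maps to stage 1, which is empty here, so the empty map is a
    section; \<open>undefined\<close> everywhere is its extensional form.\<close>
  then have "elts (FObj S i) = {}"
    using arr_mem[OF ordinal_osucc[OF ordinal_ozero] ordinal_osucc[OF ok], folded k(2)] True by blast
  then show thesis using that[of "\<lambda>_. undefined"] by simp
next
  case False
  then obtain c where "c \<in> elts (FObj S (osucc ozero))" by blast
  from ex1_coalgebra_point[OF this ordinal_omega]
  obtain w where w: "w \<in> elts (FObj S omega)" by blast
  \<comment> \<open>With the point \<open>w\<close> available, stage 0 also has a section, and it
    serves as the base of the induction.\<close>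
  have "\<exists>s \<in> elts (FObj S i) \<rightarrow>\<^sub>E elts (FObj S omega). \<forall>x \<in> elts (FObj S i). FArr S omega i () (s x) = x"
    using assms(1)
  proof (induction i rule: mem_induct)
    case (mem i)
    from mem.prems show ?case
    proof (cases i rule: omega_cases)
      case 1
      have "FArr S omega ozero () w = ozero"
        using arr_mem[OF ordinal_ozero ordinal_omega _ w] elts_zero by simp
      then show ?thesis
        using w by (intro bexI[of _ "\<lambda>_ \<in> elts (FObj S i). w"]) (auto simp: 1 elts_zero)
    next
      case (2 k)
      have ok: "ordinal k" "elts k \<subseteq> elts omega" using 2(1) ordinal_omega ordinal_mem ordinal_subset by blast+
      have oi: "ordinal i" "elts i \<subseteq> elts omega" using mem.prems ordinal_omega ordinal_mem ordinal_subset by blast+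
      note ow = ordinal_omega ordinal_osucc[OF ordinal_omega]
      obtain s where s: "s \<in> elts (FObj S k) \<rightarrow>\<^sub>E elts (FObj S omega)"
        "\<And>x. x \<in> elts (FObj S k) \<Longrightarrow> FArr S omega k () (s x) = x"
        using mem.IH[of k] 2 by auto
      \<comment> \<open>\<open>A\<close> sends the section at \<open>k\<close> to a map from stage
        \<open>i\<close> into stage \<open>osucc omega\<close>; the connecting map then brings it
        down to \<omega>.\<close>
      let ?s = "FArr A (FObj S k) (FObj S omega) s"
      have Si: "FObj S i = FObj A (FObj S k)" using obj_succ[OF ok(1)] 2(2) by simp
      have s_mem: "?s x \<in> elts (FObj S (osucc omega))" if "x \<in> elts (FObj S i)" for x
        using functor_Sets_apply_mem[OF endofunctor s(1)] that obj_succ[OF ow(1)] Si by simp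
      have "FArr S omega i () (FArr S (osucc omega) omega () (?s x)) = x" if "x \<in> elts (FObj S i)" for x
      proof -
        have "FArr S omega i () (FArr S (osucc omega) omega () (?s x)) = FArr S (osucc omega) i () (?s x)"
          by (rule arr_comp[OF oi(1) ow oi(2) subset_osucc s_mem[OF that]])
        also have "\<dots> = x"
          using functor_Sets_cancel[OF endofunctor s(1) arr_hom[OF ok(1) ow(1) ok(2)] s(2)] that Si
            arr_succ[OF ok(1) ow(1) ok(2)] 2(2) by simp
        finally show ?thesis .
      qed
      moreover have "FArr S (osucc omega) omega () (?s x) \<in> elts (FObj S omega)"
        if "x \<in> elts (FObj S i)" for x
        by (rule arr_mem[OF ow subset_osucc s_mem[OF that]])
      ultimately show ?thesis
        by (intro bexI[of _ "\<lambda>x \<in> elts (FObj S i). FArr S (osucc omega) omega () (?s x)"]) auto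
    qed
  qed
  then show thesis using that by blast
qed

end



section \<open>Causal operations and natural transformations\<close>

locale causal_setting = SA: omega_sequence A S + SB: omega_sequence B T
  for A B :: "'v::zf_universe endofunctor" and S T :: "'v ord_diagram"
begin

lemma nat_trans_iff:
  assumes "is_functor Sets Sets F"
  shows "nat_trans Ord_op Sets (functor_comp Ord_op F S) T \<alpha> \<longleftrightarrow>
    (\<forall>i. ordinal i \<longrightarrow> \<alpha> i \<in> elts (FObj F (FObj S i)) \<rightarrow>\<^sub>E elts (FObj T i)) \<and>
    (\<forall>i j. ordinal i \<longrightarrow> ordinal j \<longrightarrow> elts i \<subseteq> elts j \<longrightarrow> (\<forall>x \<in> elts (FObj F (FObj S j)).
      \<alpha> i (FArr F (FObj S j) (FObj S i) (FArr S j i ()) x) = FArr T j i () (\<alpha> j x))) \<and>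
    \<alpha> \<in> extensional {i. ordinal i}"
  by (rule nat_trans_Ord_op_iff[OF assms SA.diagram SB.diagram])

lemma functor_arr_comp:
  fixes F :: "'v endofunctor"
  assumes F: "is_functor Sets Sets F"
    and "ordinal i" "ordinal j" "ordinal k" "elts i \<subseteq> elts j" "elts j \<subseteq> elts k"
    and "x \<in> elts (FObj F (FObj S k))"
  shows "FArr F (FObj S j) (FObj S i) (FArr S j i ()) (FArr F (FObj S k) (FObj S j) (FArr S k j ()) x) =
    FArr F (FObj S k) (FObj S i) (FArr S k i ()) x"
  using A_comp[OF F SA.arr_hom[OF assms(3,4,6)] SA.arr_hom[OF assms(2,3,5)] assms(7)]
    SA.compose_arr[OF assms(2-6)] by simp

text \<open>\<open>F\<close> preserves split epimorphisms: \<open>F\<close> applied to a section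
  supplies the preimage.\<close>

lemma functor_section:
  fixes F :: "'v endofunctor"
  assumes F: "is_functor Sets Sets F" and i: "i \<in> elts omega" "i \<noteq> ozero"
    and y: "y \<in> elts (FObj F (FObj S i))"
  obtains x where "x \<in> elts (FObj F (FObj S omega))"
    "FArr F (FObj S omega) (FObj S i) (FArr S omega i ()) x = y"
proof -
  have o: "ordinal i" "elts i \<subseteq> elts omega"
    using i(1) ordinal_omega ordinal_mem ordinal_subset by blast+
  obtain s where s: "s \<in> elts (FObj S i) \<rightarrow>\<^sub>E elts (FObj S omega)"
      "\<And>x. x \<in> elts (FObj S i) \<Longrightarrow> FArr S omega i () (s x) = x"
    using SA.section_omega[OF i] by blast
  show thesis
    by (rule that[OF functor_Sets_apply_mem[OF F s(1) y]
          functor_Sets_cancel[OF F s(1) SA.arr_hom[OF o(1) ordinal_omega o(2)] s(2) y]])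
qed

section \<open>Determination by the component at \<omega>\<close>

text \<open>Stage 0 has a singleton target. For \<open>0 < i < \<omega>\<close> the naturality
  square with \<omega> has a surjective map into its source at \<open>i\<close>, and for
  \<open>i \<ge> \<omega>\<close> an injective map out of its target at \<open>i\<close>.\<close>

lemma nat_trans_eqI:
  assumes F: "is_functor Sets Sets F"
    and \<alpha>: "nat_trans Ord_op Sets (functor_comp Ord_op F S) T \<alpha>"
    and \<beta>: "nat_trans Ord_op Sets (functor_comp Ord_op F S) T \<beta>"
    and eq: "\<alpha> omega = \<beta> omega"
  shows "\<alpha> = \<beta>"
proof (rule extensionalityI)
  show "\<alpha> \<in> extensional {i. ordinal i}" "\<beta> \<in> extensional {i. ordinal i}"
    using \<alpha> \<beta> nat_trans_iff[OF F] by blast+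
  fix i :: 'v assume "i \<in> {i. ordinal i}"
  then have i: "ordinal i" by simp
  have hom: "\<alpha> i \<in> elts (FObj F (FObj S i)) \<rightarrow>\<^sub>E elts (FObj T i)"
      "\<beta> i \<in> elts (FObj F (FObj S i)) \<rightarrow>\<^sub>E elts (FObj T i)"
    using \<alpha> \<beta> i nat_trans_iff[OF F] by blast+
  have nat: "\<alpha> m (FArr F (FObj S j) (FObj S m) (FArr S j m ()) x) = FArr T j m () (\<alpha> j x)"
      "\<beta> m (FArr F (FObj S j) (FObj S m) (FArr S j m ()) x) = FArr T j m () (\<beta> j x)"
    if "ordinal m" "ordinal j" "elts m \<subseteq> elts j" "x \<in> elts (FObj F (FObj S j))" for m j x
    using \<alpha> \<beta> that nat_trans_iff[OF F] by blast+
  show "\<alpha> i = \<beta> i"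
  proof (rule PiE_ext[OF hom])
    fix y assume y: "y \<in> elts (FObj F (FObj S i))"
    have mem: "\<alpha> i y \<in> elts (FObj T i)" "\<beta> i y \<in> elts (FObj T i)" using hom y by blast+
    consider "i = ozero" | "i \<in> elts omega" "i \<noteq> ozero" | "elts omega \<subseteq> elts i"
      using omega_dichotomy[OF i] by blast
    then show "\<alpha> i y = \<beta> i y"
    proof cases
      case 1
      then show ?thesis using mem SB.elts_zero by simp
    next
      case 2
      obtain x where x: "x \<in> elts (FObj F (FObj S omega))"
        "FArr F (FObj S omega) (FObj S i) (FArr S omega i ()) x = y"
        using functor_section[OF F 2 y] by blast
      then show ?thesis
        using nat[OF i ordinal_omega ordinal_subset[OF ordinal_omega 2(1)] x(1)] eq by simp
    next
      case 3
      have "FArr T i omega () (\<alpha> i y) = FArr T i omega () (\<beta> i y)"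
        using nat[OF ordinal_omega i 3 y] eq by simp
      then show ?thesis
        using SB.bij_betw_omega[OF i 3] mem by (meson bij_betw_def inj_onD)
    qed
  qed
qed

section \<open>Evaluation at \<omega> and extension of causal operations\<close>

text \<open>Naturality moves the projection to stage \<open>i\<close> across
  \<open>\<alpha>\<close>, giving \<open>\<alpha> i\<close> after \<open>F\<close> of the projected
  map. So only the projection of \<open>f\<close> or \<open>g\<close> to stage \<open>i\<close>
  matters.\<close>

lemma causal_operation_nat_trans:
  assumes F: "is_functor Sets Sets F"
    and \<alpha>: "nat_trans Ord_op Sets (functor_comp Ord_op F S) T \<alpha>"
  shows "causal_operation F S T (\<alpha> omega)"
  unfolding causal_operation_iff[OF F]
proof (intro conjI allI ballI impI)
  show "\<alpha> omega \<in> elts (FObj F (FObj S omega)) \<rightarrow>\<^sub>E elts (FObj T omega)"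
    using \<alpha> ordinal_omega nat_trans_iff[OF F] by blast
  fix X f g and i x :: 'v
  assume f: "f \<in> elts X \<rightarrow>\<^sub>E elts (FObj S omega)" and g: "g \<in> elts X \<rightarrow>\<^sub>E elts (FObj S omega)"
    and i: "i \<in> elts omega" and fg: "\<forall>x \<in> elts X. FArr S omega i () (f x) = FArr S omega i () (g x)"
    and x: "x \<in> elts (FObj F X)"
  have o: "ordinal i" "elts i \<subseteq> elts omega"
    using i ordinal_omega ordinal_mem ordinal_subset by blast+
  have "FArr T omega i () (\<alpha> omega (FArr F X (FObj S omega) h x)) =
      \<alpha> i (FArr F X (FObj S i) (compose (elts X) (FArr S omega i ()) h) x)"
    if h: "h \<in> elts X \<rightarrow>\<^sub>E elts (FObj S omega)" for h
  proof -
    have "FArr T omega i () (\<alpha> omega (FArr F X (FObj S omega) h x)) =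
        \<alpha> i (FArr F (FObj S omega) (FObj S i) (FArr S omega i ()) (FArr F X (FObj S omega) h x))"
      using \<alpha> o ordinal_omega functor_Sets_apply_mem[OF F h x] nat_trans_iff[OF F] by metis
    then show ?thesis
      using A_comp[OF F h SA.arr_hom[OF o(1) ordinal_omega o(2)] x] by simp
  qed
  moreover have "compose (elts X) (FArr S omega i ()) f = compose (elts X) (FArr S omega i ()) g"
    using fg by (simp add: compose_eq_compose_iff)
  ultimately show "FArr T omega i () (\<alpha> omega (FArr F X (FObj S omega) f x)) =
      FArr T omega i () (\<alpha> omega (FArr F X (FObj S omega) g x))"
    using f g by simp
qed

text \<open>Each component is built on its own, constrained only by its naturality square with
  \<omega>. Which of the two implications is in force depends on the side of \<omega> on which
  \<open>i\<close> lies.\<close>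

lemma causal_operation_component:
  assumes F: "is_functor Sets Sets F" and a: "causal_operation F S T a" and i: "ordinal i"
  shows "\<exists>h. h \<in> elts (FObj F (FObj S i)) \<rightarrow>\<^sub>E elts (FObj T i) \<and>
    (elts omega \<subseteq> elts i \<longrightarrow> (\<forall>x \<in> elts (FObj F (FObj S i)).
      FArr T i omega () (h x) = a (FArr F (FObj S i) (FObj S omega) (FArr S i omega ()) x))) \<and>
    (i \<in> elts omega \<longrightarrow> (\<forall>x \<in> elts (FObj F (FObj S omega)).
      h (FArr F (FObj S omega) (FObj S i) (FArr S omega i ()) x) = FArr T omega i () (a x)))"
proof -
  have a_mem: "a x \<in> elts (FObj T omega)" if "x \<in> elts (FObj F (FObj S omega))" for x
    using a that unfolding causal_operation_iff[OF F] by blast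
  have irr: "\<not> elts omega \<subseteq> elts i" if "i \<in> elts omega"
    using that mem_irrefl[of i] by blast
  consider "i = ozero" | "i \<in> elts omega" "i \<noteq> ozero" | "elts omega \<subseteq> elts i"
    using omega_dichotomy[OF i] by blast
  then show ?thesis
  proof cases
    case 1
    have z: "ozero \<in> elts omega" using elts_omega by (metis funpow_0 rangeI)
    have hom: "FArr S omega ozero () \<in> elts (FObj S omega) \<rightarrow>\<^sub>E elts (FObj S ozero)"
      by (rule SA.arr_hom[OF ordinal_ozero ordinal_omega]) simp
    have "FArr T omega ozero () (a x) = ozero" if "x \<in> elts (FObj F (FObj S omega))" for x
      using SB.arr_mem[OF ordinal_ozero ordinal_omega _ a_mem[OF that]] SB.elts_zero by simp
    then show ?thesis
      using irr z functor_Sets_apply_mem[OF F hom] unfolding 1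
      by (intro exI[of _ "\<lambda>_ \<in> elts (FObj F (FObj S ozero)). ozero"]) (auto simp: SB.elts_zero)
  next
    case 2
    have oi: "elts i \<subseteq> elts omega" using ordinal_subset[OF ordinal_omega 2(1)] .
    obtain s where s: "s \<in> elts (FObj S i) \<rightarrow>\<^sub>E elts (FObj S omega)"
        "\<And>x. x \<in> elts (FObj S i) \<Longrightarrow> FArr S omega i () (s x) = x"
      using SA.section_omega[OF 2] by blast
    note p = SA.arr_hom[OF i ordinal_omega oi]
    let ?h = "\<lambda>x \<in> elts (FObj F (FObj S i)). FArr T omega i () (a (FArr F (FObj S i) (FObj S omega) s x))"
    have "?h \<in> elts (FObj F (FObj S i)) \<rightarrow>\<^sub>E elts (FObj T i)"
      using SB.arr_mem[OF i ordinal_omega oi a_mem[OF functor_Sets_apply_mem[OF F s(1)]]] by auto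
    moreover have "?h (FArr F (FObj S omega) (FObj S i) (FArr S omega i ()) x) = FArr T omega i () (a x)"
      if x: "x \<in> elts (FObj F (FObj S omega))" for x
    proof -
      \<comment> \<open>Causality is applied with \<open>X\<close> equal to stage \<omega>, to the
        section after the projection and to the identity; these agree at stage \<open>i\<close>
        because \<open>s\<close> is a section.\<close>
      let ?sp = "compose (elts (FObj S omega)) s (FArr S omega i ())"
      let ?id = "\<lambda>y \<in> elts (FObj S omega). y"
      have sp: "?sp \<in> elts (FObj S omega) \<rightarrow>\<^sub>E elts (FObj S omega)"
        using s(1) p by (auto simp: compose_def)
      have "FArr S omega i () (?sp y) = FArr S omega i () (?id y)" if "y \<in> elts (FObj S omega)" for y
        using that s(2) p by (auto simp: compose_def)
      moreover have "?id \<in> elts (FObj S omega) \<rightarrow>\<^sub>E elts (FObj S omega)" by auto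
      ultimately have "FArr T omega i () (a (FArr F (FObj S omega) (FObj S omega) ?sp x)) =
          FArr T omega i () (a (FArr F (FObj S omega) (FObj S omega) ?id x))"
        using a 2(1) x sp unfolding causal_operation_iff[OF F] by blast
      then show ?thesis
        using A_comp[OF F p s(1) x] A_id[OF F] x functor_Sets_apply_mem[OF F p x] by simp
    qed
    ultimately show ?thesis using irr[OF 2(1)] by blast
  next
    case 3
    \<comment> \<open>From \<omega> on, the square forces \<open>h\<close> to be \<open>a\<close>
      transported back along the bijection of the second sequence.\<close>
    let ?inv = "inv_into (elts (FObj T i)) (FArr T i omega ())"
    let ?a = "\<lambda>x. a (FArr F (FObj S i) (FObj S omega) (FArr S i omega ()) x)"
    note b = SB.bij_betw_omega[OF i 3]
    have m: "?a x \<in> elts (FObj T omega)" if "x \<in> elts (FObj F (FObj S i))" for x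
      by (rule a_mem[OF functor_Sets_apply_mem[OF F SA.arr_hom[OF ordinal_omega i 3] that]])
    have "?inv z \<in> elts (FObj T i)" "FArr T i omega () (?inv z) = z" if "z \<in> elts (FObj T omega)" for z
      using that b bij_betw_inv_into_right[OF b that] by (auto simp: bij_betw_def intro: inv_into_into)
    then show ?thesis
      using irr 3 m by (intro exI[of _ "\<lambda>x \<in> elts (FObj F (FObj S i)). ?inv (?a x)"]) auto
  qed
qed

text \<open>The components chosen separately are natural for all pairs of stages, since every such
  square reduces to the squares with \<omega>.\<close>

lemma causal_operation_extends:
  assumes F: "is_functor Sets Sets F" and a: "causal_operation F S T a"
  obtains \<alpha> where "nat_trans Ord_op Sets (functor_comp Ord_op F S) T \<alpha>" "\<alpha> omega = a"
proof -
  have a_hom: "a \<in> elts (FObj F (FObj S omega)) \<rightarrow>\<^sub>E elts (FObj T omega)"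
    using a unfolding causal_operation_iff[OF F] by blast
  obtain h where h: "\<And>i. ordinal i \<Longrightarrow> h i \<in> elts (FObj F (FObj S i)) \<rightarrow>\<^sub>E elts (FObj T i)"
      "\<And>i x. ordinal i \<Longrightarrow> elts omega \<subseteq> elts i \<Longrightarrow> x \<in> elts (FObj F (FObj S i)) \<Longrightarrow>
        FArr T i omega () (h i x) = a (FArr F (FObj S i) (FObj S omega) (FArr S i omega ()) x)"
      "\<And>i x. ordinal i \<Longrightarrow> i \<in> elts omega \<Longrightarrow> x \<in> elts (FObj F (FObj S omega)) \<Longrightarrow>
        h i (FArr F (FObj S omega) (FObj S i) (FArr S omega i ()) x) = FArr T omega i () (a x)"
    using causal_operation_component[OF F a] by metis
  have h_mem: "h i x \<in> elts (FObj T i)" if "ordinal i" "x \<in> elts (FObj F (FObj S i))" for i x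
    using h(1)[OF that(1)] that(2) by blast
  have nat: "h i (FArr F (FObj S j) (FObj S i) (FArr S j i ()) x) = FArr T j i () (h j x)"
    if ij: "ordinal i" "ordinal j" "elts i \<subseteq> elts j" and x: "x \<in> elts (FObj F (FObj S j))" for i j x
  proof -
    let ?y = "FArr F (FObj S j) (FObj S i) (FArr S j i ()) x"
    have y: "?y \<in> elts (FObj F (FObj S i))"
      by (rule functor_Sets_apply_mem[OF F SA.arr_hom[OF ij] x])
    \<comment> \<open>At \<open>i = 0\<close> the target is a singleton. For both stages finite,
      \<open>x\<close> is lifted to stage \<omega>; across \<omega>, the square is cut there; from
      \<omega> on, the equation is tested after the injective map to stage \<omega>.\<close>
    consider "i = ozero" | "j \<in> elts omega" "i \<noteq> ozero" | "i \<in> elts omega" "elts omega \<subseteq> elts j"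
      | "elts omega \<subseteq> elts i"
      using omega_dichotomy[OF ij(1)] omega_dichotomy[OF ij(2)] by blast
    then show ?thesis
    proof cases
      case 1
      then show ?thesis
        using h_mem[OF ij(1) y] SB.arr_mem[OF ij h_mem[OF ij(2) x]] SB.elts_zero by simp
    next
      case 2
      have wj: "elts j \<subseteq> elts omega" using ordinal_subset[OF ordinal_omega 2(1)] .
      have iw: "i \<in> elts omega" using ordinal_le_iff[OF ij(1,2)] ij(3) 2(1) wj by blast
      have "j \<noteq> ozero" using 2(2) ij(3) elts_ext[of i ozero] by auto
      then obtain z where z: "z \<in> elts (FObj F (FObj S omega))"
        "FArr F (FObj S omega) (FObj S j) (FArr S omega j ()) z = x"
        using functor_section[OF F 2(1) _ x] by blast
      have az: "a z \<in> elts (FObj T omega)" using a_hom z(1) by blast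
      have "h i ?y = FArr T omega i () (a z)"
        using functor_arr_comp[OF F ij(1,2) ordinal_omega ij(3) wj z(1)] h(3)[OF ij(1) iw z(1)] z(2) by simp
      also have "\<dots> = FArr T j i () (h j x)"
        using SB.arr_comp[OF ij(1,2) ordinal_omega ij(3) wj az] h(3)[OF ij(2) 2(1) z(1)] z(2) by simp
      finally show ?thesis .
    next
      case 3
      have iw: "elts i \<subseteq> elts omega" using ordinal_subset[OF ordinal_omega 3(1)] .
      let ?z = "FArr F (FObj S j) (FObj S omega) (FArr S j omega ()) x"
      have z: "?z \<in> elts (FObj F (FObj S omega))"
        by (rule functor_Sets_apply_mem[OF F SA.arr_hom[OF ordinal_omega ij(2) 3(2)] x])
      have "h i ?y = FArr T omega i () (a ?z)"
        using functor_arr_comp[OF F ij(1) ordinal_omega ij(2) iw 3(2) x] h(3)[OF ij(1) 3(1) z] by simp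
      also have "\<dots> = FArr T j i () (h j x)"
        using SB.arr_comp[OF ij(1) ordinal_omega ij(2) iw 3(2) h_mem[OF ij(2) x]] h(2)[OF ij(2) 3(2) x] by simp
      finally show ?thesis .
    next
      case 4
      have wj: "elts omega \<subseteq> elts j" using 4 ij(3) by blast
      have "FArr T i omega () (h i ?y) = FArr T i omega () (FArr T j i () (h j x))"
        using h(2)[OF ij(1) 4 y] h(2)[OF ij(2) wj x] functor_arr_comp[OF F ordinal_omega ij(1,2) 4 ij(3) x]
          SB.arr_comp[OF ordinal_omega ij(1,2) 4 ij(3) h_mem[OF ij(2) x]] by simp
      then show ?thesis
        using SB.bij_betw_omega[OF ij(1) 4] h_mem[OF ij(1) y] SB.arr_mem[OF ij h_mem[OF ij(2) x]]
        by (meson bij_betw_def inj_onD)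
    qed
  qed
  \<comment> \<open>In the square of \<omega> with itself both connecting maps are
    identities.\<close>
  have "h omega = a"
  proof (rule PiE_ext[OF h(1)[OF ordinal_omega] a_hom])
    fix x assume x: "x \<in> elts (FObj F (FObj S omega))"
    have id: "FArr S omega omega () = (\<lambda>y \<in> elts (FObj S omega). y)"
      by (rule PiE_ext[OF SA.arr_hom[OF ordinal_omega ordinal_omega order_refl]])
        (auto simp: SA.arr_id[OF ordinal_omega])
    have "FArr T omega omega () (h omega x) = a x"
      using h(2)[OF ordinal_omega order_refl x] A_id[OF F] x by (simp add: id)
    then show "h omega x = a x" using SB.arr_id[OF ordinal_omega h_mem[OF ordinal_omega x]] by simp
  qed
  moreover have "ordinal (omega :: 'v)" by (rule ordinal_omega)
  ultimately show thesis
    using h(1) nat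
    by (intro that[of "restrict h {i. ordinal i}"]) (simp_all add: nat_trans_iff[OF F])
qed

lemma bij_betw_eval_omega:
  assumes F: "is_functor Sets Sets F"
  shows "bij_betw (\<lambda>\<alpha>. \<alpha> omega)
    {\<alpha>. nat_trans Ord_op Sets (functor_comp Ord_op F S) T \<alpha>} {a. causal_operation F S T a}"
proof -
  have "inj_on (\<lambda>\<alpha>. \<alpha> omega) {\<alpha>. nat_trans Ord_op Sets (functor_comp Ord_op F S) T \<alpha>}"
    using nat_trans_eqI[OF F] by (auto intro: inj_onI)
  moreover have "a \<in> (\<lambda>\<alpha>. \<alpha> omega) ` {\<alpha>. nat_trans Ord_op Sets (functor_comp Ord_op F S) T \<alpha>}"
    if "causal_operation F S T a" for a
    using causal_operation_extends[OF F that] by blast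
  ultimately show ?thesis
    using causal_operation_nat_trans[OF F] unfolding bij_betw_def by blast
qed

section \<open>Triangles and the isomorphism of categories\<close>

text \<open>Both sides of the full triangle are natural transformations with the same source and
  target, so by \<open>nat_trans_eqI\<close> they can be compared at \<omega>.\<close>

lemma triangle_iff_triangle_omega:
  assumes \<alpha>: "nat_trans Ord_op Sets (functor_comp Ord_op F S) T \<alpha>"
    and \<beta>: "nat_trans Ord_op Sets (functor_comp Ord_op G S) T \<beta>"
    and \<kappa>: "nat_trans Sets Sets F G \<kappa>"
  shows "nat_comp Ord_op Sets (functor_comp Ord_op F S) (functor_comp Ord_op G S) T
      \<beta> (whisker Ord_op \<kappa> S) = \<alpha> \<longleftrightarrow>
    Comp Sets (FObj F (FObj S omega)) (FObj G (FObj S omega)) (FObj T omega)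
      (\<beta> omega) (\<kappa> (FObj S omega)) = \<alpha> omega"
    (is "?\<gamma> = \<alpha> \<longleftrightarrow> ?c = _")
proof -
  have F: "is_functor Sets Sets F" using \<kappa> by (simp add: nat_trans_def)
  have "(omega :: 'v) \<in> Obj Ord_op" by (simp add: Ord_op_def ord_op_on_def ordinal_omega)
  then have c: "?\<gamma> omega = ?c" by (simp add: nat_comp_def functor_comp_def whisker_def)
  have "nat_trans Ord_op Sets (functor_comp Ord_op F S) T ?\<gamma>"
    by (rule nat_trans_comp[OF is_category_Sets nat_trans_whisker[OF is_category_Ord_op \<kappa> SA.diagram] \<beta>])
  then show ?thesis using nat_trans_eqI[OF F _ \<alpha>, of ?\<gamma>] c by auto
qed

lemma is_category_Causal_cat: "is_category (Causal_cat S T)"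
proof -
  have id: "nat_id Sets Sets F X = (\<lambda>x \<in> elts (FObj F X). x)" for F :: "'v endofunctor" and X
    by (simp add: nat_id_def Sets_def)
  have comp: "nat_comp Sets Sets F G H \<mu> \<kappa> X = compose (elts (FObj F X)) (\<mu> X) (\<kappa> X)"
    for F G H :: "'v endofunctor" and \<mu> \<kappa> X
    by (simp add: nat_comp_def Sets_def)
  have hom: "\<kappa> X \<in> elts (FObj F X) \<rightarrow>\<^sub>E elts (FObj G X)" if "nat_trans Sets Sets F G \<kappa>" for F G \<kappa> X
    using that by (simp add: nat_trans_def Sets_def)
  have unit: "compose P f (\<lambda>x \<in> P. x) = f" "compose P (\<lambda>x \<in> Q. x) f = f" if "f \<in> P \<rightarrow>\<^sub>E Q"
    for P Q :: "'v set" and f :: "'v \<Rightarrow> 'v"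
    using that by (auto simp: compose_def fun_eq_iff)
  have assoc: "compose P (compose Q h g) f = compose P h (compose P g f)" if "f \<in> P \<rightarrow>\<^sub>E Q"
    for P Q :: "'v set" and f g h :: "'v \<Rightarrow> 'v"
    using that by (auto simp: compose_def fun_eq_iff)
  have C: "Comp Sets X Y Z = compose (elts X)" for X Y Z :: 'v by (simp add: Sets_def)
  show ?thesis
    unfolding is_category_def
  proof (intro conjI ballI)
    fix x assume "x \<in> Obj (Causal_cat S T)"
    then show "Id (Causal_cat S T) x \<in> Hom (Causal_cat S T) x x"
      using nat_trans_id[OF is_category_Sets]
      by (auto simp: Causal_cat_def id C unit causal_operation_iff)
  next
    fix x y z f g
    assume "x \<in> Obj (Causal_cat S T)" "y \<in> Obj (Causal_cat S T)" "z \<in> Obj (Causal_cat S T)"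
      "f \<in> Hom (Causal_cat S T) x y" "g \<in> Hom (Causal_cat S T) y z"
    \<comment> \<open>Two commuting triangles paste by associativity of
      \<open>compose\<close>.\<close>
    then show "Comp (Causal_cat S T) x y z g f \<in> Hom (Causal_cat S T) x z"
      by (auto simp: Causal_cat_def comp C assoc[OF hom, symmetric]
          intro: nat_trans_comp[OF is_category_Sets])
  next
    fix x y f
    assume "x \<in> Obj (Causal_cat S T)" "y \<in> Obj (Causal_cat S T)" "f \<in> Hom (Causal_cat S T) x y"
    then show "Comp (Causal_cat S T) x x y f (Id (Causal_cat S T) x) = f"
      "Comp (Causal_cat S T) x y y (Id (Causal_cat S T) y) f = f"
      by (auto simp: Causal_cat_def fun_eq_iff[of "nat_comp _ _ _ _ _ _ _"] comp id unit[OF hom])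
  next
    fix w x y z f g h
    assume "w \<in> Obj (Causal_cat S T)" "x \<in> Obj (Causal_cat S T)" "y \<in> Obj (Causal_cat S T)"
      "z \<in> Obj (Causal_cat S T)" "f \<in> Hom (Causal_cat S T) w x" "g \<in> Hom (Causal_cat S T) x y"
      "h \<in> Hom (Causal_cat S T) y z"
    then show "Comp (Causal_cat S T) w x z (Comp (Causal_cat S T) x y z h g) f =
        Comp (Causal_cat S T) w y z h (Comp (Causal_cat S T) w x y g f)"
      by (auto simp: Causal_cat_def fun_eq_iff[of "nat_comp _ _ _ _ _ _ _"] comp assoc[OF hom])
  qed
qed

text \<open>Objects correspond by evaluation at \<omega>. Arrows are the same transformations
  \<open>\<kappa>\<close> on both sides, because the two triangle conditions are equivalent.\<close>

lemma isomorphic_Causal_cat_K_cat: "isomorphic_categories (Causal_cat S T) (K_cat S T)"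
proof (rule isomorphic_categoriesI[OF is_category_Causal_cat, of "\<lambda>(F, \<alpha>). (F, \<alpha> omega)"])
  show "bij_betw (\<lambda>(F, \<alpha>). (F, \<alpha> omega)) (Obj (K_cat S T)) (Obj (Causal_cat S T))"
  proof (rule bij_betw_imageI)
    show "inj_on (\<lambda>(F, \<alpha>). (F, \<alpha> omega)) (Obj (K_cat S T))"
      using nat_trans_eqI by (auto simp: inj_on_def K_cat_def)
    show "(\<lambda>(F, \<alpha>). (F, \<alpha> omega)) ` Obj (K_cat S T) = Obj (Causal_cat S T)"
    proof (intro equalityI subsetI)
      fix p assume "p \<in> (\<lambda>(F, \<alpha>). (F, \<alpha> omega)) ` Obj (K_cat S T)"
      then show "p \<in> Obj (Causal_cat S T)"
        using causal_operation_nat_trans by (auto simp: K_cat_def Causal_cat_def)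
    next
      fix p assume "p \<in> Obj (Causal_cat S T)"
      then obtain F a where p: "p = (F, a)" "is_functor Sets Sets F" "causal_operation F S T a"
        by (auto simp: Causal_cat_def)
      obtain \<alpha> where "nat_trans Ord_op Sets (functor_comp Ord_op F S) T \<alpha>" "\<alpha> omega = a"
        using causal_operation_extends[OF p(2,3)] by blast
      then show "p \<in> (\<lambda>(F, \<alpha>). (F, \<alpha> omega)) ` Obj (K_cat S T)"
        using p(1,2) by (intro image_eqI[of _ _ "(F, \<alpha>)"]) (auto simp: K_cat_def)
    qed
  qed
next
  fix x y assume "x \<in> Obj (K_cat S T)" "y \<in> Obj (K_cat S T)"
  then obtain F \<alpha> G \<beta> where xy: "x = (F, \<alpha>)" "y = (G, \<beta>)"
    and \<alpha>: "nat_trans Ord_op Sets (functor_comp Ord_op F S) T \<alpha>"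
    and \<beta>: "nat_trans Ord_op Sets (functor_comp Ord_op G S) T \<beta>"
    by (auto simp: K_cat_def)
  show "Hom (K_cat S T) x y =
      Hom (Causal_cat S T) (case x of (F, \<alpha>) \<Rightarrow> (F, \<alpha> omega)) (case y of (F, \<alpha>) \<Rightarrow> (F, \<alpha> omega))"
    using triangle_iff_triangle_omega[OF \<alpha> \<beta>] by (auto simp: xy K_cat_def Causal_cat_def)
qed (auto simp: K_cat_def Causal_cat_def)

end

theorem theorem8p6:
  fixes A B F :: "'v::zf_universe endofunctor"
    and S T :: "'v ord_diagram"
  assumes "is_functor Sets Sets A" and "is_functor Sets Sets B" and "is_functor Sets Sets F"
    and "omega_continuous A" and "omega_continuous B"
    and "final_sequence A S" and "final_sequence B T"
  shows "bij_betw (\<lambda>\<alpha>. \<alpha> omega)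
           {\<alpha>. nat_trans Ord_op Sets (functor_comp Ord_op F S) T \<alpha>}
           {\<alpha>\<^sub>\<omega>. causal_operation F S T \<alpha>\<^sub>\<omega>}
    \<and> (\<forall>G \<alpha> \<beta> \<kappa>.
         is_functor Sets Sets G \<and>
         nat_trans Ord_op Sets (functor_comp Ord_op F S) T \<alpha> \<and>
         nat_trans Ord_op Sets (functor_comp Ord_op G S) T \<beta> \<and>
         nat_trans Sets Sets F G \<kappa> \<longrightarrow>
         (nat_comp Ord_op Sets (functor_comp Ord_op F S) (functor_comp Ord_op G S) T
            \<beta> (whisker Ord_op \<kappa> S) = \<alpha> \<longleftrightarrow>
          Comp Sets (FObj F (FObj S omega)) (FObj G (FObj S omega)) (FObj T omega)
            (\<beta> omega) (\<kappa> (FObj S omega)) = \<alpha> omega))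
    \<and> isomorphic_categories (Causal_cat S T) (K_cat S T)"
proof -
  interpret causal_setting A B S T
    using assms by unfold_locales
  show ?thesis
    using bij_betw_eval_omega[OF assms(3)] triangle_iff_triangle_omega isomorphic_Causal_cat_K_cat
    by blast
qed

end
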